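(* Let $X^h$ be a subspace of $V$ consisting of piecewise polynomials with respect to the triangulation $\mathcal{T}_h$, and suppose there exists a type II interior edge $e\in\mathcal{E}_h^I$ with $e=\partial T_1\cap\partial T_2$, where $T_1,T_2\in\mathcal{T}_h$. Then for every $v\in X^h$ there holds $v\in H^2(T_1\cup T_2)$.
   Context: $\Omega\subset\mathbf{R}^2$ is a bounded domain with piecewise smooth boundary, and $\mathcal{T}_h$ is a quasi-uniform triangulation of $\Omega$ with mesh size $h\in(0,1)$. $\mathcal{E}_h^I$ is the set of interior edges of $\mathcal{T}_h$, i.e. edges common to two triangles of $\mathcal{T}_h$. With $\Box v:=\partial_{xx}v-\partial_{yy}v$ (in the sense of distributions), $V:=\{v\in H^1(\Omega):\ \Box v\in L^2(\Omega)\}$. "Piecewise polynomial" means that the restriction to each $T\in\mathcal{T}_h$ is a polynomial. For an edge $e$ with unit normal $n=(n_1,n_2)$ and unit tangent $\tau$, put $\bar n:=(n_1,-n_2)$. The edge $e$ is called type I if $\bar n=\tau$ or $\bar n=-\tau$ (equivalently, $e$ makes an angle $\pm\pi/4$ with the $x$-axis); otherwise it is called type II. *)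

theory Defs
  imports "HOL-Analysis.Analysis"
begin

type_synonym plane = "real \<times> real"

text \<open>Elements of Lebesgue and Sobolev spaces on \<open>\<Omega>\<close> are represented by functions on the whole
  plane of which only the values almost everywhere on \<open>\<Omega>\<close> matter.\<close>

definition dx :: "(plane \<Rightarrow> real) \<Rightarrow> plane \<Rightarrow> real" where
  "dx f p = frechet_derivative f (at p) (1, 0)"

definition dy :: "(plane \<Rightarrow> real) \<Rightarrow> plane \<Rightarrow> real" where
  "dy f p = frechet_derivative f (at p) (0, 1)"

primrec Ck :: "nat \<Rightarrow> (plane \<Rightarrow> real) \<Rightarrow> bool" where
  "Ck 0 f \<longleftrightarrow> continuous_on UNIV f"
| "Ck (Suc k) f \<longleftrightarrow> (\<forall>p. f differentiable (at p)) \<and> Ck k (dx f) \<and> Ck k (dy f)"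

definition test_functions :: "plane set \<Rightarrow> (plane \<Rightarrow> real) set" where
  "test_functions \<Omega> =
     {\<phi>. (\<forall>k. Ck k \<phi>) \<and> compact (closure {p. \<phi> p \<noteq> 0}) \<and> closure {p. \<phi> p \<noteq> 0} \<subseteq> \<Omega>}"

definition L2 :: "plane set \<Rightarrow> (plane \<Rightarrow> real) set" where
  "L2 \<Omega> = {f. f \<in> borel_measurable (lebesgue_on \<Omega>) \<and> integrable (lebesgue_on \<Omega>) (\<lambda>p. (f p)\<^sup>2)}"

text \<open>A distribution on \<open>\<Omega>\<close> is a functional of which only the values on \<open>test_functions \<Omega>\<close> matter.\<close>

type_synonym distribution = "(plane \<Rightarrow> real) \<Rightarrow> real"

definition distr_of :: "plane set \<Rightarrow> (plane \<Rightarrow> real) \<Rightarrow> distribution" where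
  "distr_of \<Omega> f = (\<lambda>\<phi>. LINT p|lebesgue_on \<Omega>. f p * \<phi> p)"

definition ddx :: "distribution \<Rightarrow> distribution" where
  "ddx L = (\<lambda>\<phi>. - L (dx \<phi>))"

definition ddy :: "distribution \<Rightarrow> distribution" where
  "ddy L = (\<lambda>\<phi>. - L (dy \<phi>))"

definition wave_op :: "distribution \<Rightarrow> distribution" where
  "wave_op L = (\<lambda>\<phi>. ddx (ddx L) \<phi> - ddy (ddy L) \<phi>)"

definition distr_in_L2 :: "plane set \<Rightarrow> distribution \<Rightarrow> bool" where
  "distr_in_L2 \<Omega> L \<longleftrightarrow> (\<exists>g\<in>L2 \<Omega>. \<forall>\<phi>\<in>test_functions \<Omega>. L \<phi> = distr_of \<Omega> g \<phi>)"

definition sobolev :: "nat \<Rightarrow> plane set \<Rightarrow> (plane \<Rightarrow> real) set" where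
  "sobolev k \<Omega> = {v \<in> L2 \<Omega>. \<forall>i j. i + j \<le> k \<longrightarrow>
     distr_in_L2 \<Omega> ((ddx ^^ i) ((ddy ^^ j) (distr_of \<Omega> v)))}"

definition V_space :: "plane set \<Rightarrow> (plane \<Rightarrow> real) set" where
  "V_space \<Omega> = {v \<in> sobolev 1 \<Omega>. distr_in_L2 \<Omega> (wave_op (distr_of \<Omega> v))}"

definition fun_subspace :: "(plane \<Rightarrow> real) set \<Rightarrow> bool" where
  "fun_subspace X \<longleftrightarrow> (\<lambda>p. 0) \<in> X \<and> (\<forall>u\<in>X. \<forall>v\<in>X. (\<lambda>p. u p + v p) \<in> X)
     \<and> (\<forall>c. \<forall>u\<in>X. (\<lambda>p. c * u p) \<in> X)"

definition regular_smooth_on :: "real \<Rightarrow> real \<Rightarrow> (real \<Rightarrow> plane) \<Rightarrow> bool" where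
  "regular_smooth_on a b g \<longleftrightarrow> (\<exists>D :: nat \<Rightarrow> real \<Rightarrow> plane.
     (\<forall>t\<in>{a..b}. D 0 t = g t \<and> D 1 t \<noteq> 0) \<and>
     (\<forall>k. \<forall>t\<in>{a..b}. (D k has_vector_derivative D (Suc k) t) (at t within {a..b})))"

definition piecewise_smooth_path :: "(real \<Rightarrow> plane) \<Rightarrow> bool" where
  "piecewise_smooth_path g \<longleftrightarrow> (\<exists>ts. ts \<noteq> [] \<and> sorted_wrt (<) ts \<and> hd ts = 0 \<and> last ts = 1 \<and>
     (\<forall>i. Suc i < length ts \<longrightarrow> regular_smooth_on (ts ! i) (ts ! Suc i) g))"

text \<open>The boundary consists of finitely many closed curves: \<open>\<Omega>\<close> may have holes, but slits
  and isolated boundary points are excluded.\<close>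

definition piecewise_smooth_boundary :: "plane set \<Rightarrow> bool" where
  "piecewise_smooth_boundary \<Omega> \<longleftrightarrow> (\<exists>\<Gamma>. finite \<Gamma> \<and> frontier \<Omega> = (\<Union>\<gamma>\<in>\<Gamma>. path_image \<gamma>) \<and>
     (\<forall>\<gamma>\<in>\<Gamma>. simple_path \<gamma> \<and> pathfinish \<gamma> = pathstart \<gamma> \<and> piecewise_smooth_path \<gamma>))"

definition bounded_domain :: "plane set \<Rightarrow> bool" where
  "bounded_domain \<Omega> \<longleftrightarrow> open \<Omega> \<and> connected \<Omega> \<and> bounded \<Omega> \<and> \<Omega> \<noteq> {}"

text \<open>A triangle is encoded by the set of its three edges. Since \<open>\<Omega>\<close> need not be a polygon, an edge
  lying on the boundary of \<open>\<Omega>\<close> may be curved; all other edges are straight. For a triangle with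
  three straight edges, \<open>region\<close> is the convex hull of the vertices.\<close>

type_synonym triangle = "plane set set"

definition region :: "triangle \<Rightarrow> plane set" where
  "region K = \<Union>K \<union> inside (\<Union>K)"

definition is_side :: "plane set \<Rightarrow> plane \<Rightarrow> plane \<Rightarrow> plane set \<Rightarrow> bool" where
  "is_side \<Omega> a b e \<longleftrightarrow> (\<exists>g. arc g \<and> regular_smooth_on 0 1 g \<and> pathstart g = a \<and> pathfinish g = b \<and>
     path_image g = e \<and> (e = closed_segment a b \<or> e \<subseteq> frontier \<Omega>))"

definition is_triangle :: "plane set \<Rightarrow> triangle \<Rightarrow> bool" where
  "is_triangle \<Omega> K \<longleftrightarrow> (\<exists>a b c e1 e2 e3. \<not> collinear {a, b, c} \<and>
     is_side \<Omega> a b e1 \<and> is_side \<Omega> b c e2 \<and> is_side \<Omega> c a e3 \<and>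
     e1 \<inter> e2 = {b} \<and> e2 \<inter> e3 = {c} \<and> e3 \<inter> e1 = {a} \<and> K = {e1, e2, e3})"

definition vertices :: "triangle \<Rightarrow> plane set" where
  "vertices K = {p. \<exists>e\<in>K. \<exists>e'\<in>K. e \<noteq> e' \<and> p \<in> e \<inter> e'}"

definition is_triangulation :: "plane set \<Rightarrow> triangle set \<Rightarrow> bool" where
  "is_triangulation \<Omega> \<T> \<longleftrightarrow> finite \<T> \<and> \<T> \<noteq> {} \<and> (\<forall>K\<in>\<T>. is_triangle \<Omega> K) \<and>
     (\<Union>K\<in>\<T>. region K) = closure \<Omega> \<and>
     (\<forall>K\<in>\<T>. \<forall>K'\<in>\<T>. K \<noteq> K' \<longrightarrow>
        region K \<inter> region K' = {} \<or>
        (\<exists>p \<in> vertices K \<inter> vertices K'. region K \<inter> region K' = {p}) \<or>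
        (\<exists>e \<in> K \<inter> K'. region K \<inter> region K' = e))"

definition mesh_size :: "triangle set \<Rightarrow> real" where
  "mesh_size \<T> = Max ((\<lambda>K. diameter (region K)) ` \<T>)"

text \<open>\<open>\<kappa>\<close> is the quasi-uniformity constant, to be thought of as common to all members \<open>\<T>\<close> of a
  family of triangulations.\<close>

definition quasi_uniform :: "real \<Rightarrow> triangle set \<Rightarrow> bool" where
  "quasi_uniform \<kappa> \<T> \<longleftrightarrow> (\<forall>K\<in>\<T>. \<exists>p. ball p (\<kappa> * mesh_size \<T>) \<subseteq> region K)"

definition interior_edges :: "triangle set \<Rightarrow> plane set set" where
  "interior_edges \<T> = {e. \<exists>K\<in>\<T>. \<exists>K'\<in>\<T>. K \<noteq> K' \<and> e \<in> K \<and> e \<in> K'}"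

definition piecewise_polynomial :: "triangle set \<Rightarrow> (plane \<Rightarrow> real) \<Rightarrow> bool" where
  "piecewise_polynomial \<T> v \<longleftrightarrow>
     (\<forall>K\<in>\<T>. \<exists>q. real_polynomial_function q \<and> (AE p in lebesgue_on (region K). v p = q p))"

definition unit_tangent :: "plane set \<Rightarrow> plane \<Rightarrow> bool" where
  "unit_tangent e \<tau> \<longleftrightarrow> (\<exists>a b. a \<noteq> b \<and> e = closed_segment a b \<and> \<tau> = (b - a) /\<^sub>R norm (b - a))"

definition unit_normal :: "plane set \<Rightarrow> plane \<Rightarrow> bool" where
  "unit_normal e n \<longleftrightarrow> norm n = 1 \<and> (\<exists>\<tau>. unit_tangent e \<tau> \<and> n \<bullet> \<tau> = 0)"

definition bar :: "plane \<Rightarrow> plane" where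
  "bar n = (fst n, - snd n)"

text \<open>Unit normal and unit tangent are determined up to sign, so it does not matter which ones are
  chosen in the following definition.\<close>

definition type_I :: "plane set \<Rightarrow> bool" where
  "type_I e \<longleftrightarrow> (\<exists>n \<tau>. unit_normal e n \<and> unit_tangent e \<tau> \<and> (bar n = \<tau> \<or> bar n = - \<tau>))"

definition type_II :: "plane set \<Rightarrow> bool" where
  "type_II e \<longleftrightarrow> (\<exists>a b. a \<noteq> b \<and> e = closed_segment a b) \<and> \<not> type_I e"

end

theory Submission
  imports Defs
begin

text \<open>
  Let \<open>q\<close> be the difference of the two polynomials on \<open>T1\<close> and \<open>T2\<close>, and \<open>n\<close> a unit normal of \<open>e\<close>.
  Integration by parts on the two sides of \<open>e\<close> shows that the distributional gradient of \<open>v\<close>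
  contains the measure \<open>q n\<close> on \<open>e\<close>; as the gradient is square integrable, \<open>q = 0\<close> on \<open>e\<close>, hence the
  tangential derivative of \<open>q\<close> vanishes too. Now \<open>\<box>v\<close> contains the measure
  \<open>n\<^sub>1 \<partial>\<^sub>x q - n\<^sub>2 \<partial>\<^sub>y q\<close> on \<open>e\<close>, which must vanish again. For an edge of type II,
  \<open>n\<^sub>1\<^sup>2 \<noteq> n\<^sub>2\<^sup>2\<close>, so the two linear equations force the gradient of \<open>q\<close> to vanish on \<open>e\<close>. Thus \<open>v\<close> is \<open>C\<^sup>1\<close>
  across \<open>e\<close>, and its piecewise second derivatives are its weak second derivatives.
\<close>

subsection \<open>Smooth functions on the plane\<close>

text \<open>Type I edges lie on the characteristic lines of the wave operator. Once
  \<open>q = 0\<close> on \<open>e\<close>, the tangential condition and the wave condition read n1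
  q_y = n2 q_x and n1 q_x = n2 q_y. The determinant n1^2 - n2^2 vanishes exactly in the
  characteristic directions, across which a gradient jump is compatible with the wave operator.
  Continuity has to come first: if \<open>q\<close> did not vanish on \<open>e\<close>, integrating
  the wave operator by parts would also leave derivatives of the test function on the edge. The
  geometric obstacle is that other sides of the two triangles may be curved, so it is not given that
  the regions are the two sides of a straight line near a point of \<open>e\<close>. Hence there are
  two settings. Jumps are computed at one point of the edge at a time, in a disc cut by a line. The
  final gluing takes place in the interior of the union, with two closed sets of which it is only
  known that they cover it and meet on a line.\<close>

definition smooth :: "(plane \<Rightarrow> real) \<Rightarrow> bool" where
  "smooth f \<longleftrightarrow> (\<forall>k. Ck k f)"

lemma smooth_differentiable: "smooth f \<Longrightarrow> f differentiable (at p)"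
  unfolding smooth_def using Ck.simps(2) by blast

lemma smooth_continuous_on: "smooth f \<Longrightarrow> continuous_on S f"
  by (meson Ck.simps(1) continuous_on_subset smooth_def subset_UNIV)

lemma smooth_borel_measurable: "smooth f \<Longrightarrow> f \<in> borel_measurable borel"
  by (simp add: borel_measurable_continuous_onI smooth_continuous_on)

lemma smooth_dx: "smooth f \<Longrightarrow> smooth (dx f)"
  and smooth_dy: "smooth f \<Longrightarrow> smooth (dy f)"
  unfolding smooth_def using Ck.simps(2) by blast+

lemma smooth_has_derivative:
  assumes "smooth f"
  shows "(f has_derivative (\<lambda>h. dx f p * fst h + dy f p * snd h)) (at p)"
proof -
  have D: "(f has_derivative frechet_derivative f (at p)) (at p)"
    using assms frechet_derivative_works smooth_differentiable by blast
  then interpret bounded_linear "frechet_derivative f (at p)"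
    by (rule has_derivative_bounded_linear)
  have "frechet_derivative f (at p) h = dx f p * fst h + dy f p * snd h" for h
  proof -
    have "h = fst h *\<^sub>R (1, 0) + snd h *\<^sub>R (0, 1)" by (cases h) simp
    then have "frechet_derivative f (at p) h = frechet_derivative f (at p) (fst h *\<^sub>R (1, 0) + snd h *\<^sub>R (0, 1))"
      by simp
    also have "\<dots> = dx f p * fst h + dy f p * snd h"
      by (simp only: add scaleR dx_def dy_def) simp
    finally show ?thesis .
  qed
  then have "frechet_derivative f (at p) = (\<lambda>h. dx f p * fst h + dy f p * snd h)" ..
  then show ?thesis using D by simp
qed

text \<open>Total derivatives are always brought into this normal form, because it yields both
  partials at once.\<close>

lemma has_derivative_dx_eq:
  assumes "(f has_derivative (\<lambda>h. a * fst h + b * snd h)) (at p)"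
  shows "dx f p = a" and "dy f p = b"
  by (simp_all add: dx_def dy_def frechet_derivative_at[OF assms, symmetric])

lemma Ck_Suc_imp: "Ck (Suc k) f \<Longrightarrow> Ck k f"
proof (induction k arbitrary: f)
  case 0
  then show ?case
    by (metis Ck.simps differentiable_at_imp_differentiable_on differentiable_imp_continuous_on)
next
  case (Suc k)
  then show ?case by (metis Ck.simps(2))
qed

lemma Ck_const: "Ck k (\<lambda>p. c)"
proof (induction k arbitrary: c)
  case (Suc k)
  have "dx (\<lambda>p. c) = (\<lambda>p. 0)" "dy (\<lambda>p. c) = (\<lambda>p. 0)"
    by (auto simp: dx_def dy_def fun_eq_iff)
  then show ?case using Suc by simp
qed simp

lemma dx_add:
  assumes "f differentiable (at p)" "g differentiable (at p)"
  shows "dx (\<lambda>p. f p + g p) p = dx f p + dx g p" "dy (\<lambda>p. f p + g p) p = dy f p + dy g p"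
proof -
  have "((\<lambda>p. f p + g p) has_derivative (\<lambda>h. frechet_derivative f (at p) h + frechet_derivative g (at p) h)) (at p)"
    using assms by (intro has_derivative_add) (auto simp: frechet_derivative_works)
  from frechet_derivative_at[OF this, symmetric]
  show "dx (\<lambda>p. f p + g p) p = dx f p + dx g p" "dy (\<lambda>p. f p + g p) p = dy f p + dy g p"
    by (simp_all add: dx_def dy_def)
qed

lemma dx_mult:
  assumes "f differentiable (at p)" "g differentiable (at p)"
  shows "dx (\<lambda>p. f p * g p) p = dx f p * g p + f p * dx g p"
    "dy (\<lambda>p. f p * g p) p = dy f p * g p + f p * dy g p"
proof -
  have "((\<lambda>p. f p * g p) has_derivative (\<lambda>h. f p * frechet_derivative g (at p) h + frechet_derivative f (at p) h * g p)) (at p)"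
    using assms by (intro has_derivative_mult) (auto simp: frechet_derivative_works)
  from frechet_derivative_at[OF this]
  have "frechet_derivative (\<lambda>p. f p * g p) (at p) = (\<lambda>h. f p * frechet_derivative g (at p) h + frechet_derivative f (at p) h * g p)" ..
  then show "dx (\<lambda>p. f p * g p) p = dx f p * g p + f p * dx g p"
    "dy (\<lambda>p. f p * g p) p = dy f p * g p + f p * dy g p"
    by (simp_all add: dx_def dy_def)
qed

lemma Ck_add: "Ck k f \<Longrightarrow> Ck k g \<Longrightarrow> Ck k (\<lambda>p. f p + g p)"
proof (induction k arbitrary: f g)
  case 0
  then show ?case by (auto intro: continuous_on_add)
next
  case (Suc k)
  then have "dx (\<lambda>p. f p + g p) = (\<lambda>p. dx f p + dx g p)" "dy (\<lambda>p. f p + g p) = (\<lambda>p. dy f p + dy g p)"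
    by (auto simp: dx_add)
  with Suc show ?case by simp
qed

lemma Ck_mult: "Ck k f \<Longrightarrow> Ck k g \<Longrightarrow> Ck k (\<lambda>p. f p * g p)"
proof (induction k arbitrary: f g)
  case 0
  then show ?case by (auto intro: continuous_on_mult)
next
  case (Suc k)
  then have "dx (\<lambda>p. f p * g p) = (\<lambda>p. dx f p * g p + f p * dx g p)"
    "dy (\<lambda>p. f p * g p) = (\<lambda>p. dy f p * g p + f p * dy g p)"
    by (auto simp: dx_mult)
  with Suc show ?case
    using Ck_Suc_imp[OF Suc.prems(1)] Ck_Suc_imp[OF Suc.prems(2)] by (auto intro!: Ck_add)
qed

lemma smooth_const: "smooth (\<lambda>p. c)"
  and smooth_add: "smooth f \<Longrightarrow> smooth g \<Longrightarrow> smooth (\<lambda>p. f p + g p)"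
  and smooth_mult: "smooth f \<Longrightarrow> smooth g \<Longrightarrow> smooth (\<lambda>p. f p * g p)"
  by (simp_all add: smooth_def Ck_const Ck_add Ck_mult)

lemma smooth_dx_mult:
  assumes "smooth f" "smooth g"
  shows "dx (\<lambda>p. f p * g p) = (\<lambda>p. dx f p * g p + f p * dx g p)"
    and "dy (\<lambda>p. f p * g p) = (\<lambda>p. dy f p * g p + f p * dy g p)"
  using dx_mult assms smooth_differentiable by blast+

lemma smooth_dx_add:
  assumes "smooth f" "smooth g"
  shows "dx (\<lambda>p. f p + g p) = (\<lambda>p. dx f p + dx g p)"
    and "dy (\<lambda>p. f p + g p) = (\<lambda>p. dy f p + dy g p)"
  using dx_add assms smooth_differentiable by blast+

lemma dx_const: "dx (\<lambda>p. c) = (\<lambda>p. 0)" "dy (\<lambda>p. c) = (\<lambda>p. 0)"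
  by (auto simp: dx_def dy_def)

lemma smooth_minus: "smooth f \<Longrightarrow> smooth (\<lambda>p. - f p)"
  using smooth_mult[OF smooth_const[of "-1"]] by fastforce

lemma smooth_diff: "smooth f \<Longrightarrow> smooth g \<Longrightarrow> smooth (\<lambda>p. f p - g p)"
  using smooth_add[OF _ smooth_minus] by fastforce

lemma smooth_dx_minus:
  assumes "smooth f"
  shows "dx (\<lambda>p. - f p) = (\<lambda>p. - dx f p)" "dy (\<lambda>p. - f p) = (\<lambda>p. - dy f p)"
  using smooth_dx_mult[OF smooth_const[of "-1"] assms] by (simp_all add: dx_const)

lemma smooth_dx_diff:
  assumes "smooth f" "smooth g"
  shows "dx (\<lambda>p. f p - g p) = (\<lambda>p. dx f p - dx g p)"
    and "dy (\<lambda>p. f p - g p) = (\<lambda>p. dy f p - dy g p)"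
  using smooth_dx_add[OF assms(1) smooth_minus[OF assms(2)]] smooth_dx_minus[OF assms(2)] by simp_all

lemma bounded_linear_dx:
  assumes "bounded_linear f"
  shows "dx f = (\<lambda>p. f (1, 0))" "dy f = (\<lambda>p. f (0, 1))"
  by (simp_all add: dx_def dy_def fun_eq_iff
      frechet_derivative_at[OF bounded_linear_imp_has_derivative[OF assms], symmetric])

lemma smooth_bounded_linear: "bounded_linear f \<Longrightarrow> smooth f"
proof -
  assume f: "bounded_linear f"
  have "Ck k f" for k
    by (cases k) (use f in \<open>auto simp: bounded_linear_dx Ck_const linear_continuous_on
        bounded_linear_imp_differentiable\<close>)
  then show ?thesis by (simp add: smooth_def)
qed

lemma smooth_real_polynomial: "real_polynomial_function q \<Longrightarrow> smooth q"
  by (induction rule: real_polynomial_function.induct)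
    (simp_all add: smooth_bounded_linear smooth_const smooth_add smooth_mult)

lemma dx_compose:
  assumes "smooth u" "(H has_real_derivative D) (at (u p))"
  shows "dx (\<lambda>p. H (u p)) p = D * dx u p" "dy (\<lambda>p. H (u p)) p = D * dy u p"
    "(\<lambda>p. H (u p)) differentiable (at p)"
proof -
  have "((\<lambda>p. H (u p)) has_derivative (\<lambda>h. D * (dx u p * fst h + dy u p * snd h))) (at p)"
    using has_derivative_compose[OF smooth_has_derivative[OF assms(1)], of H "(*) D"] assms(2)
    by (simp add: has_field_derivative_def)
  then have *: "((\<lambda>p. H (u p)) has_derivative (\<lambda>h. (D * dx u p) * fst h + (D * dy u p) * snd h)) (at p)"
    by (simp add: algebra_simps)
  show "dx (\<lambda>p. H (u p)) p = D * dx u p" "dy (\<lambda>p. H (u p)) p = D * dy u p"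
    using has_derivative_dx_eq[OF *] by auto
  show "(\<lambda>p. H (u p)) differentiable (at p)"
    using * by (rule differentiableI)
qed

text \<open>A smooth function of one variable is given here by the sequence of its derivatives. The
  claim covers every member \<open>H i\<close>, since the chain rule for \<open>H i\<close> brings
  in \<open>H (Suc i)\<close> and the induction on \<open>k\<close> must apply to it.\<close>

lemma smooth_compose:
  fixes H :: "nat \<Rightarrow> real \<Rightarrow> real"
  assumes "smooth u" "\<And>i t. (H i has_real_derivative H (Suc i) t) (at t)"
  shows "smooth (\<lambda>p. H i (u p))"
proof -
  have "Ck k (\<lambda>p. H i (u p))" for k
  proof (induction k arbitrary: i)
    case 0
    have "continuous_on UNIV (H i)"
      using assms(2) DERIV_isCont continuous_at_imp_continuous_on by blast
    then show ?case
      using assms(1) continuous_on_compose2 smooth_continuous_on by fastforce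
  next
    case (Suc k)
    have "dx (\<lambda>p. H i (u p)) = (\<lambda>p. H (Suc i) (u p) * dx u p)"
      "dy (\<lambda>p. H i (u p)) = (\<lambda>p. H (Suc i) (u p) * dy u p)"
      using dx_compose[OF assms(1) assms(2)] by blast+
    then show ?case
      using Suc[of "Suc i"] assms smooth_dx smooth_dy dx_compose(3)[OF assms(1) assms(2)]
      by (simp add: Ck_mult smooth_def)
  qed
  then show ?thesis by (simp add: smooth_def)
qed

lemma smooth_exp: "smooth u \<Longrightarrow> smooth (\<lambda>p. exp (u p))"
  using smooth_compose[of u "\<lambda>i. exp" 0] DERIV_exp by blast

text \<open>The functions \<open>P(1/t) exp(-1/t)\<close>, extended by zero to \<open>t \<le> 0\<close>, are closed under
  differentiation, which makes the classical bump function a test function.\<close>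

lemma tendsto_poly_exp_neg: "((\<lambda>x::real. poly P x * exp (- x)) \<longlongrightarrow> 0) at_top"
proof -
  have "((\<lambda>x::real. \<Sum>i\<le>degree P. coeff P i * (x ^ i / exp x)) \<longlongrightarrow> (\<Sum>i\<le>degree P. coeff P i * 0)) at_top"
    by (intro tendsto_sum tendsto_mult tendsto_const tendsto_power_div_exp_0)
  then show ?thesis
    by (simp add: poly_altdef sum_divide_distrib exp_minus field_simps)
qed

definition flat_exp :: "real poly \<Rightarrow> real \<Rightarrow> real" where
  "flat_exp P t = (if t > 0 then poly P (1 / t) * exp (- (1 / t)) else 0)"

text \<open>With x = 1/t the operator d/dt becomes -x^2 d/dx, which sends P(x) exp(-x) to x^2 (P -
  P')(x) exp(-x); \<open>[:0, 0, 1:]\<close> is x^2.\<close>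

lemma flat_exp_deriv:
  "(flat_exp P has_real_derivative flat_exp ([:0, 0, 1:] * (P - pderiv P)) t) (at t)"
proof -
  consider "t > 0" | "t < 0" | "t = 0" by linarith
  then show ?thesis
  proof cases
    case 1
    have "((\<lambda>t. poly P (1 / t) * exp (- (1 / t))) has_real_derivative
        flat_exp ([:0, 0, 1:] * (P - pderiv P)) t) (at t)"
      using 1 by (auto intro!: derivative_eq_intros DERIV_chain2[OF poly_DERIV]
        simp: flat_exp_def field_simps power2_eq_square)
    then show ?thesis
      by (rule has_field_derivative_transform_within_open[of _ _ _ "{0<..}"])
        (use 1 in \<open>auto simp: flat_exp_def\<close>)
  next
    case 2
    have "((\<lambda>t. 0) has_real_derivative flat_exp ([:0, 0, 1:] * (P - pderiv P)) t) (at t)"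
      using 2 by (auto simp: flat_exp_def)
    then show ?thesis
      by (rule has_field_derivative_transform_within_open[of _ _ _ "{..<0}"])
        (use 2 in \<open>auto simp: flat_exp_def\<close>)
  next
    case 3
    \<comment> \<open>The difference quotient at 0 from the right is x P(x) exp(-x) with x = 1/h,
      hence the factor \<open>[:0, 1:]\<close>.\<close>
    have "((\<lambda>h. poly ([:0, 1:] * P) (inverse h) * exp (- inverse h)) \<longlongrightarrow> 0) (at_right (0::real))"
      using filterlim_compose[OF tendsto_poly_exp_neg filterlim_inverse_at_top_right] by blast
    then have "((\<lambda>h. flat_exp P h / h) \<longlongrightarrow> 0) (at_right 0)"
      by (rule Lim_transform_eventually)
        (auto simp: flat_exp_def eventually_at_filter field_simps)
    moreover have "((\<lambda>h. flat_exp P h / h) \<longlongrightarrow> 0) (at_left 0)"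
      by (rule Lim_transform_eventually[OF tendsto_const])
        (auto simp: flat_exp_def eventually_at_filter)
    ultimately have "((\<lambda>h. flat_exp P h / h) \<longlongrightarrow> 0) (at 0)"
      using filterlim_split_at by blast
    then show ?thesis using 3 by (simp add: DERIV_def flat_exp_def)
  qed
qed

lemma smooth_flat_exp: "smooth u \<Longrightarrow> smooth (\<lambda>p. flat_exp P (u p))"
  using smooth_compose[of u "\<lambda>i. flat_exp (((\<lambda>P. [:0, 0, 1:] * (P - pderiv P)) ^^ i) P)" 0] flat_exp_deriv
  by simp

subsection \<open>Test functions and integration by parts across a line\<close>

lemma test_smooth: "\<phi> \<in> test_functions W \<Longrightarrow> smooth \<phi>"
  by (simp add: test_functions_def smooth_def)

lemma test_outside: "\<phi> \<in> test_functions W \<Longrightarrow> p \<notin> W \<Longrightarrow> \<phi> p = 0"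
  using closure_subset[of "{p. \<phi> p \<noteq> 0}"] by (auto simp: test_functions_def)

text \<open>The closure on the right is what derivatives require: \<open>dx \<phi>\<close> can be
  nonzero at a zero of \<open>\<phi>\<close>, but only inside the closed support.\<close>

lemma test_functionsI:
  assumes "smooth \<psi>" "\<phi> \<in> test_functions W" "{p. \<psi> p \<noteq> 0} \<subseteq> closure {p. \<phi> p \<noteq> 0}"
  shows "\<psi> \<in> test_functions W"
proof -
  have *: "closure {p. \<psi> p \<noteq> 0} \<subseteq> closure {p. \<phi> p \<noteq> 0}"
    using assms(3) by (simp add: closure_minimal)
  with assms(2) have "compact (closure {p. \<psi> p \<noteq> 0})"
    by (metis (no_types, lifting) Int_absorb1 closed_closure compact_Int_closed inf_commute mem_Collect_eq test_functions_def)
  with * assms show ?thesis by (auto simp: test_functions_def smooth_def)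
qed

lemma test_mult: "smooth f \<Longrightarrow> \<phi> \<in> test_functions W \<Longrightarrow> (\<lambda>p. f p * \<phi> p) \<in> test_functions W"
  by (rule test_functionsI[OF smooth_mult[OF _ test_smooth]])
    (use closure_subset[of "{p. \<phi> p \<noteq> 0}"] in auto)

lemma test_mono: "\<phi> \<in> test_functions U \<Longrightarrow> U \<subseteq> W \<Longrightarrow> \<phi> \<in> test_functions W"
  by (auto simp: test_functions_def)

text \<open>The product is 0 in a whole neighbourhood of \<open>p\<close>, whatever \<open>g\<close>
  is. This allows \<open>g\<close> to be a glued function with jumps.\<close>

lemma zero_has_derivative_outside_support:
  assumes "p \<notin> closure {p. \<phi> p \<noteq> (0::real)}"
  shows "((\<lambda>p. g p * \<phi> p) has_derivative (\<lambda>h. 0 * fst h + 0 * snd h)) (at (p::plane))"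
proof -
  have "((\<lambda>p. 0) has_derivative (\<lambda>h. 0 * fst h + 0 * snd h)) (at p)" by simp
  then show ?thesis
    by (rule has_derivative_transform_within_open[of _ _ _ _ "- closure {p. \<phi> p \<noteq> 0}"])
      (use assms closure_subset[of "{p. \<phi> p \<noteq> 0}"] in auto)
qed

lemma dx_outside_support:
  assumes "p \<notin> closure {p. \<phi> p \<noteq> (0::real)}"
  shows "dx \<phi> p = 0" "dy \<phi> p = 0"
  using has_derivative_dx_eq[OF zero_has_derivative_outside_support[OF assms, of "\<lambda>p. 1"]] by simp_all

lemma test_dx: "\<phi> \<in> test_functions W \<Longrightarrow> dx \<phi> \<in> test_functions W"
  and test_dy: "\<phi> \<in> test_functions W \<Longrightarrow> dy \<phi> \<in> test_functions W"
  using dx_outside_support[of _ \<phi>]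
  by (auto intro!: test_functionsI[OF smooth_dx[OF test_smooth]] test_functionsI[OF smooth_dy[OF test_smooth]])

lemma integrable_test_lborel:
  assumes "\<phi> \<in> test_functions W"
  shows "integrable lborel \<phi>"
proof -
  let ?K = "closure {p. \<phi> p \<noteq> 0}"
  have "integrable lborel (\<lambda>p. indicator ?K p *\<^sub>R \<phi> p)"
    using assms by (intro borel_integrable_compact smooth_continuous_on test_smooth)
      (auto simp: test_functions_def)
  moreover have "(\<lambda>p. indicator ?K p *\<^sub>R \<phi> p) = \<phi>"
    using closure_subset[of "{p. \<phi> p \<noteq> 0}"] by (auto simp: fun_eq_iff indicator_def)
  ultimately show ?thesis by simp
qed

text \<open>Only one region is stored. On a line shared with a second region the value is that of
  \<open>f\<close>, which concerns a null set.\<close>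

definition glue :: "plane set \<Rightarrow> (plane \<Rightarrow> real) \<Rightarrow> (plane \<Rightarrow> real) \<Rightarrow> plane \<Rightarrow> real" where
  "glue A f g p = (if p \<in> A then f p else g p)"

lemma integrable_test: "\<phi> \<in> test_functions U \<Longrightarrow> integrable lebesgue \<phi>"
  using integrable_test_lborel integrable_completion borel_measurable_integrable by blast

lemma glue_same: "glue A f f = f"
  by (auto simp: glue_def)

lemma integrable_glue_test_lborel:
  assumes "A \<in> sets borel" "smooth f" "smooth g" "\<phi> \<in> test_functions W"
  shows "integrable lborel (\<lambda>p. glue A f g p * \<phi> p)"
proof -
  have "integrable lborel (\<lambda>p. indicator A p *\<^sub>R (f p * \<phi> p) + indicator (- A) p *\<^sub>R (g p * \<phi> p))"
    using assms(1) integrable_test_lborel[OF test_mult[OF assms(2,4)]] integrable_test_lborel[OF test_mult[OF assms(3,4)]]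
    by (intro Bochner_Integration.integrable_add integrable_mult_indicator) auto
  moreover have "(\<lambda>p. indicator A p *\<^sub>R (f p * \<phi> p) + indicator (- A) p *\<^sub>R (g p * \<phi> p)) = (\<lambda>p. glue A f g p * \<phi> p)"
    by (auto simp: glue_def fun_eq_iff)
  ultimately show ?thesis by simp
qed

lemma integrable_glue_test:
  assumes "A \<in> sets borel" "smooth f" "smooth g" "\<phi> \<in> test_functions W"
  shows "integrable lebesgue (\<lambda>p. glue A f g p * \<phi> p)"
  using integrable_glue_test_lborel[OF assms] integrable_completion borel_measurable_integrable by blast

section \<open>Integrals of derivatives of compactly supported functions\<close>

lemma has_integral_zero_of_bounded_support:
  fixes f F :: "real \<Rightarrow> real"
  assumes "finite S" "continuous_on UNIV f" "\<And>t. R \<le> \<bar>t\<bar> \<Longrightarrow> f t = 0"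
    and der: "\<And>t. t \<notin> S \<Longrightarrow> (f has_real_derivative F t) (at t)"
  shows "(F has_integral 0) UNIV"
proof -
  define M where "M = max R 1"
  have M: "0 < M" "\<And>t. M \<le> \<bar>t\<bar> \<Longrightarrow> f t = 0"
    using assms(3) by (auto simp: M_def)
  have "(F has_integral (f M - f (- M))) {- M..M}"
    using M(1) der assms(1,2)
    by (intro fundamental_theorem_of_calculus_strong[of S])
      (auto simp: has_real_derivative_iff_has_vector_derivative intro: continuous_on_subset)
  then have "(F has_integral 0) {- M..M}" using M by simp
  then have *: "((\<lambda>t. if t \<in> {- M..M} then F t else 0) has_integral 0) UNIV"
    by (simp only: has_integral_restrict_UNIV)
  show ?thesis
  proof (rule has_integral_spike_finite[OF assms(1) _ *])
    fix t assume t: "t \<in> UNIV - S"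
    show "F t = (if t \<in> {- M..M} then F t else 0)"
    proof (cases "t \<in> {- M..M}")
      case False
      have "((\<lambda>t. 0) has_real_derivative F t) (at t)"
        by (rule has_field_derivative_transform_within_open[OF der, of _ "- {- M..M}"])
          (use t False M in auto)
      then have "F t = 0" by (rule DERIV_unique) simp
      then show ?thesis by simp
    qed simp
  qed
qed

text \<open>A non-integrable \<open>F\<close> has integral 0 by convention. So the lemma applies to
  every section of an integrable function of two variables, without sorting out the exceptional
  sections.\<close>

lemma integral_zero_of_bounded_support:
  fixes f F :: "real \<Rightarrow> real"
  assumes "finite S" "continuous_on UNIV f" "\<And>t. R \<le> \<bar>t\<bar> \<Longrightarrow> f t = 0"
    and "\<And>t. t \<notin> S \<Longrightarrow> (f has_real_derivative F t) (at t)"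
  shows "integral\<^sup>L lborel F = 0"
proof (cases "integrable lborel F")
  case True
  then show ?thesis
    using has_integral_integral_lborel has_integral_zero_of_bounded_support[OF assms] has_integral_unique by blast
qed (simp add: not_integrable_integral_eq)

lemma has_derivative_section:
  assumes "(f has_derivative (\<lambda>h. a * fst h + b * snd h)) (at (x, y))"
  shows "((\<lambda>t. f (t, y)) has_real_derivative a) (at x)"
    and "((\<lambda>t. f (x, t)) has_real_derivative b) (at y)"
proof -
  have "((\<lambda>t. (t, y)) has_derivative (\<lambda>h. (h, 0))) (at x)"
    by (auto intro!: derivative_eq_intros)
  from has_derivative_compose[OF this assms]
  show "((\<lambda>t. f (t, y)) has_real_derivative a) (at x)"
    by (simp add: has_field_derivative_def)
  have "((\<lambda>t. (x, t)) has_derivative (\<lambda>h. (0, h))) (at y)"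
    by (auto intro!: derivative_eq_intros)
  from has_derivative_compose[OF this assms]
  show "((\<lambda>t. f (x, t)) has_real_derivative b) (at y)"
    by (simp add: has_field_derivative_def)
qed

lemma finite_linear_zeros: "a \<noteq> 0 \<or> b \<noteq> (c::real) \<Longrightarrow> finite {t::real. t * a + b = c}"
  by (cases "a = 0") (auto intro: finite_subset[of _ "{(c - b) / a}"] simp: field_simps)

text \<open>By Fubini the integral of \<open>a\<close> is taken along horizontal lines and that of
  \<open>b\<close> along vertical ones. Such a line meets the exceptional line in at most one point,
  or is contained in it; the latter happens for at most one coordinate value, which is a null
  set.\<close>

lemma integral_partial_derivatives_zero:
  fixes f a b :: "plane \<Rightarrow> real" and n :: plane
  assumes cont: "continuous_on UNIV f" and supp: "\<And>p. R \<le> norm p \<Longrightarrow> f p = 0"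
    and n: "n \<noteq> 0" and int: "integrable lborel a" "integrable lborel b"
    and der: "\<And>p. p \<bullet> n \<noteq> c \<Longrightarrow> (f has_derivative (\<lambda>h. a p * fst h + b p * snd h)) (at p)"
  shows "integral\<^sup>L lborel a = 0" "integral\<^sup>L lborel b = 0"
proof -
  obtain n1 n2 where n12: "n = (n1, n2)" by (cases n)
  have sec: "continuous_on UNIV (\<lambda>t. f (t, y))" "continuous_on UNIV (\<lambda>t. f (x, t))" for x y
    by (intro continuous_on_compose2[OF cont] continuous_intros; simp)+
  have supp': "f (t, y) = 0" "f (y, t) = 0" if "R \<le> \<bar>t\<bar>" for t y
    using supp[of "(t, y)"] supp[of "(y, t)"] that norm_fst_le[of t y] norm_snd_le[of t y]
    unfolding real_norm_def by (auto simp: add_eq_0_iff)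
  \<comment> \<open>The horizontal line at height \<open>y\<close> is contained in the exceptional
    line exactly if \<open>n1 = 0\<close> and \<open>y = c / n2\<close>.\<close>
  have 1: "(LINT x|lborel. a (x, y)) = 0" if "n1 \<noteq> 0 \<or> y \<noteq> c / n2" for y
  proof (rule integral_zero_of_bounded_support[OF finite_linear_zeros sec(1)])
    show "n1 \<noteq> 0 \<or> y * n2 \<noteq> c" using that n n12 by (auto simp: zero_prod_def)
    show "((\<lambda>t. f (t, y)) has_real_derivative a (x, y)) (at x)" if "x \<notin> {t. t * n1 + y * n2 = c}" for x
      using has_derivative_section(1)[OF der] that n12 by (simp add: inner_Pair)
  qed (rule supp')
  have 2: "(LINT y|lborel. b (x, y)) = 0" if "n2 \<noteq> 0 \<or> x \<noteq> c / n1" for x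
  proof (rule integral_zero_of_bounded_support[OF finite_linear_zeros sec(2)])
    show "n2 \<noteq> 0 \<or> x * n1 \<noteq> c" using that n n12 by (auto simp: zero_prod_def)
    show "((\<lambda>t. f (x, t)) has_real_derivative b (x, y)) (at y)" if "y \<notin> {t. t * n2 + x * n1 = c}" for y
      using has_derivative_section(2)[OF der] that n12 by (simp add: inner_Pair algebra_simps)
  qed (rule supp')
  have "integral\<^sup>L lborel a = (LINT y|lborel. LINT x|lborel. a (x, y))"
    using lborel_pair.integral_snd[of "\<lambda>x y. a (x, y)"] int(1) by (simp add: lborel_prod)
  also have "\<dots> = 0"
    \<comment> \<open>If \<open>n2 = 0\<close>, the quotient is 0 by convention and discarding this
      one height does no harm.\<close>
    by (rule integral_eq_zero_AE, rule eventually_mono[OF AE_lborel_singleton[of "c / n2"]]) (use 1 in auto)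
  finally show "integral\<^sup>L lborel a = 0" .
  have "integral\<^sup>L lborel b = (LINT x|lborel. LINT y|lborel. b (x, y))"
    using lborel_pair.integral_fst'[of b] int(2) by (simp add: lborel_prod)
  also have "\<dots> = 0"
    by (rule integral_eq_zero_AE, rule eventually_mono[OF AE_lborel_singleton[of "c / n1"]]) (use 2 in auto)
  finally show "integral\<^sup>L lborel b = 0" .
qed

locale line_split =
  fixes W A1 A2 :: "plane set" and n :: plane and c :: real
  assumes W: "open W" and A1: "closed A1" and A2: "closed A2" and cover: "W \<subseteq> A1 \<union> A2"
    and on_line: "W \<inter> A1 \<inter> A2 \<subseteq> {p. p \<bullet> n = c}" and n0: "n \<noteq> 0"
begin

text \<open>The glued function may jump outside \<open>W\<close>, but there the product is 0. The
  plane is covered by the open sets \<open>W\<close> and the complement of the closed support of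
  \<open>\<phi>\<close>, and the product is continuous on each.\<close>

lemma continuous_glue_mult:
  assumes "smooth f" "smooth g" "\<And>p. p \<in> W \<inter> A1 \<inter> A2 \<Longrightarrow> f p = g p" "\<phi> \<in> test_functions W"
  shows "continuous_on UNIV (\<lambda>p. glue A1 f g p * \<phi> p)"
proof -
  let ?K = "closure {p. \<phi> p \<noteq> 0}"
  have "continuous_on ((W \<inter> A1) \<union> (W \<inter> A2)) (\<lambda>p. if p \<in> A1 then f p else g p)"
  proof (rule continuous_on_cases_local)
    have "(W \<inter> A1) \<union> (W \<inter> A2) = W" using cover by blast
    then show "closedin (top_of_set ((W \<inter> A1) \<union> (W \<inter> A2))) (W \<inter> A1)"
      "closedin (top_of_set ((W \<inter> A1) \<union> (W \<inter> A2))) (W \<inter> A2)"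
      using A1 A2 by (auto simp: closedin_closed_Int)
  qed (use assms in \<open>auto intro: smooth_continuous_on\<close>)
  moreover have "(W \<inter> A1) \<union> (W \<inter> A2) = W" using cover by blast
  ultimately have "continuous_on W (\<lambda>p. glue A1 f g p * \<phi> p)"
    unfolding glue_def by (intro continuous_on_mult smooth_continuous_on[OF test_smooth[OF assms(4)]]) simp
  moreover have "continuous_on (- ?K) (\<lambda>p. glue A1 f g p * \<phi> p)"
    by (rule continuous_on_eq[of _ "\<lambda>p. 0"]) (use closure_subset[of "{p. \<phi> p \<noteq> 0}"] in auto)
  ultimately have "continuous_on (W \<union> - ?K) (\<lambda>p. glue A1 f g p * \<phi> p)"
    using W by (intro continuous_on_open_Un) auto
  moreover have "W \<union> - ?K = UNIV" using assms(4) by (auto simp: test_functions_def)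
  ultimately show ?thesis by simp
qed

lemma glue_mult_has_derivative:
  assumes "smooth f" "smooth g" "\<phi> \<in> test_functions W" "p \<bullet> n \<noteq> c"
  shows "((\<lambda>p. glue A1 f g p * \<phi> p) has_derivative
    (\<lambda>h. (glue A1 (dx f) (dx g) p * \<phi> p + glue A1 f g p * dx \<phi> p) * fst h +
         (glue A1 (dy f) (dy g) p * \<phi> p + glue A1 f g p * dy \<phi> p) * snd h)) (at p)"
    (is "(?F has_derivative ?D) _")
proof -
  let ?K = "closure {p. \<phi> p \<noteq> 0}"
  have \<phi>: "smooth \<phi>" using assms(3) by (rule test_smooth)
  consider "p \<notin> ?K" | "p \<in> W" "p \<in> A1" "p \<notin> A2" | "p \<in> W" "p \<notin> A1"
    using assms(3,4) on_line by (auto simp: test_functions_def)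
  then show ?thesis
  proof cases
    case 1
    then have "\<phi> p = 0" using closure_subset[of "{p. \<phi> p \<noteq> 0}"] by auto
    then show ?thesis
      using zero_has_derivative_outside_support[OF 1, of "glue A1 f g"] dx_outside_support[OF 1] by simp
  next
    case 2
    have "((\<lambda>p. f p * \<phi> p) has_derivative ?D) (at p)"
      using smooth_has_derivative[OF smooth_mult[OF assms(1) \<phi>], of p] 2(2)
      by (simp add: smooth_dx_mult[OF assms(1) \<phi>] glue_def)
    then show ?thesis
      \<comment> \<open>By \<open>cover\<close>, the open set \<open>W - A2\<close> lies in
        \<open>A1\<close>, so the glued function is \<open>f\<close> near \<open>p\<close>.\<close>
      by (rule has_derivative_transform_within_open[of _ _ _ _ "W - A2"])
        (use 2 W A2 cover in \<open>auto simp: glue_def\<close>)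
  next
    case 3
    have "((\<lambda>p. g p * \<phi> p) has_derivative ?D) (at p)"
      using smooth_has_derivative[OF smooth_mult[OF assms(2) \<phi>], of p] 3(2)
      by (simp add: smooth_dx_mult[OF assms(2) \<phi>] glue_def)
    then show ?thesis
      by (rule has_derivative_transform_within_open[of _ _ _ _ "- A1"])
        (use 3 A1 in \<open>auto simp: glue_def\<close>)
  qed
qed

text \<open>Agreement on the overlap makes the product with \<open>\<phi>\<close> continuous, so its
  partial derivatives integrate to 0 and the line contributes nothing; the product rule does the
  rest.\<close>

lemma integral_by_parts_glue:
  assumes fg: "smooth f" "smooth g" "\<And>p. p \<in> W \<inter> A1 \<inter> A2 \<Longrightarrow> f p = g p" and \<phi>: "\<phi> \<in> test_functions W"
  shows "(LINT p|lebesgue. glue A1 f g p * dx \<phi> p) = - (LINT p|lebesgue. glue A1 (dx f) (dx g) p * \<phi> p)"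
    "(LINT p|lebesgue. glue A1 f g p * dy \<phi> p) = - (LINT p|lebesgue. glue A1 (dy f) (dy g) p * \<phi> p)"
proof -
  have "bounded {p. \<phi> p \<noteq> 0}"
    using \<phi> bounded_subset[OF compact_imp_bounded closure_subset] by (auto simp: test_functions_def)
  then obtain R where R: "norm p < R" if "\<phi> p \<noteq> 0" for p
    unfolding bounded_pos_less by blast
  then have supp: "glue A1 f g p * \<phi> p = 0" if "R \<le> norm p" for p
    using that by (metis linorder_not_less mult_zero_right)
  have b: "A1 \<in> sets borel" using A1 by simp
  note int = integrable_glue_test_lborel[OF b smooth_dx[OF fg(1)] smooth_dx[OF fg(2)] \<phi>]
    integrable_glue_test_lborel[OF b fg(1,2) test_dx[OF \<phi>]]
    integrable_glue_test_lborel[OF b smooth_dy[OF fg(1)] smooth_dy[OF fg(2)] \<phi>]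
    integrable_glue_test_lborel[OF b fg(1,2) test_dy[OF \<phi>]]
  note eq = integral_partial_derivatives_zero[OF continuous_glue_mult[OF fg \<phi>] supp n0
        Bochner_Integration.integrable_add[OF int(1,2)] Bochner_Integration.integrable_add[OF int(3,4)]
        glue_mult_has_derivative[OF fg(1,2) \<phi>]]
  have eq: "(LINT p|lborel. glue A1 (dx f) (dx g) p * \<phi> p + glue A1 f g p * dx \<phi> p) = 0"
    "(LINT p|lborel. glue A1 (dy f) (dy g) p * \<phi> p + glue A1 f g p * dy \<phi> p) = 0"
    by (rule eq; assumption)+
  note eq' = eq(1)[unfolded Bochner_Integration.integral_add[OF int(1,2)]]
    eq(2)[unfolded Bochner_Integration.integral_add[OF int(3,4)]]
  show "(LINT p|lebesgue. glue A1 f g p * dx \<phi> p) = - (LINT p|lebesgue. glue A1 (dx f) (dx g) p * \<phi> p)"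
    "(LINT p|lebesgue. glue A1 f g p * dy \<phi> p) = - (LINT p|lebesgue. glue A1 (dy f) (dy g) p * \<phi> p)"
    using eq' integral_completion[OF borel_measurable_integrable[OF int(1)]]
      integral_completion[OF borel_measurable_integrable[OF int(2)]]
      integral_completion[OF borel_measurable_integrable[OF int(3)]]
      integral_completion[OF borel_measurable_integrable[OF int(4)]] by (auto simp: add_eq_0_iff)
qed

end

subsection \<open>Jumps across a line\<close>

locale half_plane =
  fixes W :: "plane set" and n :: plane and c :: real
  assumes W: "open W" and norm_n: "norm n = 1"
begin

definition half :: "plane set" where "half = {p. c \<le> p \<bullet> n}"

text \<open>A Gaussian in the distance to the line: it equals 1 on the line, lies between 0 and 1,
  tends to 0 elsewhere, and its gradient is parallel to \<open>n\<close>.\<close>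

definition cutoff :: "nat \<Rightarrow> plane \<Rightarrow> real" where
  "cutoff j p = exp (- (real j * (p \<bullet> n - c)\<^sup>2))"

text \<open>Up to the sign, \<open>flux_x\<close> and \<open>flux_y\<close> are the integrals of \<open>\<psi>\<close> over the line
  \<open>p \<bullet> n = c\<close> weighted with the components of \<open>n\<close>. Since \<open>1 - cutoff j\<close> vanishes on the line, they
  do not change when \<open>\<psi>\<close> is multiplied by \<open>cutoff j\<close>, whereas integrals over the plane then tend
  to \<open>0\<close> as \<open>j\<close> grows. This replaces the trace theorem.\<close>

definition flux_x :: "(plane \<Rightarrow> real) \<Rightarrow> real" where
  "flux_x \<psi> = (LINT p|lebesgue. indicator half p * dx \<psi> p)"

definition flux_y :: "(plane \<Rightarrow> real) \<Rightarrow> real" where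
  "flux_y \<psi> = (LINT p|lebesgue. indicator half p * dy \<psi> p)"

text \<open>As \<open>n\<close> is a unit vector, for test functions this is minus the unweighted
  integral of \<open>\<psi>\<close> over the line.\<close>

definition flux_n :: "(plane \<Rightarrow> real) \<Rightarrow> real" where
  "flux_n \<psi> = fst n * flux_x \<psi> + snd n * flux_y \<psi>"

lemma n_sq: "fst n * fst n + snd n * snd n = 1"
  using norm_n by (simp add: norm_eq_1 inner_prod_def)

sublocale line_split W half "{p. p \<bullet> n \<le> c}" n c
  using W norm_n by unfold_locales (auto simp: half_def intro!: closed_Collect_le continuous_intros)

lemma half_borel: "half \<in> sets borel"
  using A1 by simp

lemma integrable_half_test:
  assumes "\<phi> \<in> test_functions W"
  shows "integrable lebesgue (\<lambda>p. indicator half p * \<phi> p)"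
  using integrable_glue_test[OF half_borel smooth_const[of 1] smooth_const[of 0] assms]
  by (simp add: glue_def indicator_def of_bool_def)

text \<open>Write the glued function as \<open>g\<close> plus \<open>f - g\<close> restricted to
  \<open>half\<close>. The first summand has no boundary term. For the second, the product rule
  applied to \<open>(f - g) * \<phi>\<close> leaves the integral of a full derivative over
  \<open>half\<close>, which is the flux by definition.\<close>

lemma glue_integral_by_parts_jump:
  assumes "smooth f" "smooth g" "\<phi> \<in> test_functions W"
  shows "(LINT p|lebesgue. glue half f g p * dx \<phi> p) =
      flux_x (\<lambda>p. (f p - g p) * \<phi> p) - (LINT p|lebesgue. glue half (dx f) (dx g) p * \<phi> p)" (is ?x)
    "(LINT p|lebesgue. glue half f g p * dy \<phi> p) =
      flux_y (\<lambda>p. (f p - g p) * \<phi> p) - (LINT p|lebesgue. glue half (dy f) (dy g) p * \<phi> p)" (is ?y)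
proof -
  note \<phi> = assms(3)
  have fg: "smooth (\<lambda>p. f p - g p)" using assms by (simp add: smooth_diff)
  have ibp: "(LINT p|lebesgue. g p * dx \<phi> p) = - (LINT p|lebesgue. dx g p * \<phi> p)"
    "(LINT p|lebesgue. g p * dy \<phi> p) = - (LINT p|lebesgue. dy g p * \<phi> p)"
    using integral_by_parts_glue[OF assms(2,2) _ \<phi>] by (simp_all add: glue_same)
  have T: "flux_x (\<lambda>p. (f p - g p) * \<phi> p) = (LINT p|lebesgue. indicator half p * ((dx f p - dx g p) * \<phi> p))
      + (LINT p|lebesgue. indicator half p * ((f p - g p) * dx \<phi> p))"
    "flux_y (\<lambda>p. (f p - g p) * \<phi> p) = (LINT p|lebesgue. indicator half p * ((dy f p - dy g p) * \<phi> p))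
      + (LINT p|lebesgue. indicator half p * ((f p - g p) * dy \<phi> p))"
    unfolding flux_x_def flux_y_def smooth_dx_mult[OF fg test_smooth[OF \<phi>]] smooth_dx_diff[OF assms(1,2)] distrib_left
    using assms(1,2) \<phi>
    by (intro Bochner_Integration.integral_add integrable_half_test test_mult smooth_diff smooth_dx smooth_dy test_dx test_dy; simp)+
  have split: "(LINT p|lebesgue. glue half u v p * \<psi> p) =
      (LINT p|lebesgue. indicator half p * ((u p - v p) * \<psi> p)) + (LINT p|lebesgue. v p * \<psi> p)"
    if "smooth u" "smooth v" "\<psi> \<in> test_functions W" for u v \<psi>
  proof -
    have "(\<lambda>p. glue half u v p * \<psi> p) = (\<lambda>p. indicator half p * ((u p - v p) * \<psi> p) + v p * \<psi> p)"
      by (auto simp: glue_def fun_eq_iff algebra_simps)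
    moreover have "(LINT p|lebesgue. indicator half p * ((u p - v p) * \<psi> p) + v p * \<psi> p) =
      (LINT p|lebesgue. indicator half p * ((u p - v p) * \<psi> p)) + (LINT p|lebesgue. v p * \<psi> p)"
      using that by (intro Bochner_Integration.integral_add integrable_half_test integrable_test[of _ W] test_mult smooth_diff)
    ultimately show ?thesis by simp
  qed
  show ?x
    using split[OF assms(1,2) test_dx[OF \<phi>]] split[OF smooth_dx[OF assms(1)] smooth_dx[OF assms(2)] \<phi>] T(1) ibp(1)
    by linarith
  show ?y
    using split[OF assms(1,2) test_dy[OF \<phi>]] split[OF smooth_dy[OF assms(1)] smooth_dy[OF assms(2)] \<phi>] T(2) ibp(2)
    by linarith
qed

lemma smooth_cutoff: "smooth (cutoff j)"
  and dx_cutoff: "dx (cutoff j) p = cutoff j p * (- 2 * real j * (p \<bullet> n - c)) * fst n"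
  and dy_cutoff: "dy (cutoff j) p = cutoff j p * (- 2 * real j * (p \<bullet> n - c)) * snd n"
proof -
  have "real_polynomial_function (\<lambda>p. - (real j * (p \<bullet> n - c)\<^sup>2))"
    by (intro real_polynomial_function_minus real_polynomial_function.intros(4) real_polynomial_function_power
        real_polynomial_function_diff real_polynomial_function.intros(2) real_polynomial_function.intros(1) bounded_linear_inner_left)
  then show "smooth (cutoff j)"
    unfolding cutoff_def[abs_def] by (intro smooth_exp smooth_real_polynomial)
  have "(cutoff j has_derivative (\<lambda>h. (cutoff j p * (- 2 * real j * (p \<bullet> n - c)) * fst n) * fst h
      + (cutoff j p * (- 2 * real j * (p \<bullet> n - c)) * snd n) * snd h)) (at p)"
    unfolding cutoff_def[abs_def]
    by (auto intro!: derivative_eq_intros simp: fun_eq_iff inner_prod_def algebra_simps)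
  from has_derivative_dx_eq[OF this]
  show "dx (cutoff j) p = cutoff j p * (- 2 * real j * (p \<bullet> n - c)) * fst n"
    "dy (cutoff j) p = cutoff j p * (- 2 * real j * (p \<bullet> n - c)) * snd n" by auto
qed

lemma flux_cutoff:
  assumes "\<psi> \<in> test_functions W"
  shows "flux_x (\<lambda>p. cutoff j p * \<psi> p) = flux_x \<psi>" "flux_y (\<lambda>p. cutoff j p * \<psi> p) = flux_y \<psi>"
proof -
  let ?f = "\<lambda>p. 1 - cutoff j p"
  have f: "smooth ?f" by (intro smooth_diff smooth_const smooth_cutoff)
  \<comment> \<open>The pair of \<open>?f\<close> and 0 agrees on the line, so integration by parts
    holds both with and without the jump term; comparing the two versions gives zero flux.\<close>
  have "flux_x (\<lambda>p. ?f p * \<psi> p) = 0" "flux_y (\<lambda>p. ?f p * \<psi> p) = 0"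
    using glue_integral_by_parts_jump[OF f smooth_const[of 0] assms]
      integral_by_parts_glue[OF f smooth_const[of 0] _ assms] by (simp_all add: cutoff_def half_def)
  moreover have "(\<lambda>p. ?f p * \<psi> p) = (\<lambda>p. \<psi> p - cutoff j p * \<psi> p)" by (simp add: algebra_simps)
  moreover have "flux_x (\<lambda>p. \<psi> p - cutoff j p * \<psi> p) = flux_x \<psi> - flux_x (\<lambda>p. cutoff j p * \<psi> p)"
    "flux_y (\<lambda>p. \<psi> p - cutoff j p * \<psi> p) = flux_y \<psi> - flux_y (\<lambda>p. cutoff j p * \<psi> p)"
    unfolding flux_x_def flux_y_def smooth_dx_diff[OF test_smooth[OF assms] test_smooth[OF test_mult[OF smooth_cutoff assms]]]
      right_diff_distrib
    using assms by (intro Bochner_Integration.integral_diff integrable_half_test test_dx test_dy test_mult smooth_cutoff; simp)+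
  ultimately show "flux_x (\<lambda>p. cutoff j p * \<psi> p) = flux_x \<psi>" "flux_y (\<lambda>p. cutoff j p * \<psi> p) = flux_y \<psi>" by simp_all
qed

lemma cutoff_le_1: "cutoff j p \<le> 1" and cutoff_nonneg: "0 \<le> cutoff j p"
  by (simp_all add: cutoff_def)

lemma cutoff_integral_tendsto_0:
  assumes "integrable lebesgue g"
  shows "(\<lambda>j. LINT p|lebesgue. cutoff j p * g p) \<longlonglongrightarrow> 0"
proof -
  have "(\<lambda>j. LINT p|lebesgue. cutoff j p * g p) \<longlonglongrightarrow> (LINT p::plane|lebesgue. 0)"
  proof (rule integral_dominated_convergence[where w = "\<lambda>p. norm (g p)"])
    show "integrable lebesgue (\<lambda>p. norm (g p))" using assms by simp
    have "cutoff j \<in> borel_measurable lebesgue" for j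
      using smooth_borel_measurable[OF smooth_cutoff] by (simp add: measurable_completion)
    then show "(\<lambda>p. cutoff j p * g p) \<in> borel_measurable lebesgue" for j
      using borel_measurable_integrable[OF assms] by (rule borel_measurable_times)
    have "negligible {p. n \<bullet> p = c}" using n0 by (intro negligible_hyperplane) simp
    then have "AE p in lebesgue. p \<notin> {p. n \<bullet> p = c}"
      unfolding negligible_iff_null_sets by (rule AE_not_in)
    then show "AE p in lebesgue. (\<lambda>j. cutoff j p * g p) \<longlonglongrightarrow> 0"
    proof eventually_elim
      case (elim p)
      then have pos: "0 < (p \<bullet> n - c)\<^sup>2" by (simp add: inner_commute)
      have "(\<lambda>j. exp (- (p \<bullet> n - c)\<^sup>2) ^ j) \<longlonglongrightarrow> 0"
        by (rule LIMSEQ_realpow_zero) (use pos in auto)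
      then have "(\<lambda>j. cutoff j p) \<longlonglongrightarrow> 0"
        by (simp add: cutoff_def exp_of_nat_mult[symmetric])
      then show ?case by (rule tendsto_mult_left_zero)
    qed
    show "AE p in lebesgue. norm (cutoff j p * g p) \<le> norm (g p)" for j
      by (simp add: abs_mult mult_left_le_one_le cutoff_le_1 cutoff_nonneg)
  qed simp
  then show ?thesis by simp
qed

text \<open>Tangential derivatives do not see \<open>cutoff j\<close>, whose gradient is parallel to
  \<open>n\<close>. Hence for every \<open>j\<close> the tangential flux is the integral of
  \<open>cutoff j\<close> times one fixed function, and letting \<open>j\<close> grow shows that it
  is 0. The flux vector is therefore a multiple of \<open>n\<close>.\<close>

lemma flux_tangential:
  assumes "\<psi> \<in> test_functions W"
  shows "flux_x \<psi> = fst n * flux_n \<psi>" "flux_y \<psi> = snd n * flux_n \<psi>"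
proof -
  let ?g = "\<lambda>p. indicator half p * (snd n * dx \<psi> p - fst n * dy \<psi> p)"
  have int: "integrable lebesgue (\<lambda>p. indicator half p * dx \<psi> p)" "integrable lebesgue (\<lambda>p. indicator half p * dy \<psi> p)"
    using assms by (intro integrable_half_test test_dx test_dy; simp)+
  have eq_g: "?g = (\<lambda>p. snd n * (indicator half p * dx \<psi> p) - fst n * (indicator half p * dy \<psi> p))"
    by (auto simp: fun_eq_iff algebra_simps)
  have "integrable lebesgue ?g" unfolding eq_g using int by simp
  moreover have "(LINT p|lebesgue. cutoff j p * ?g p) = snd n * flux_x \<psi> - fst n * flux_y \<psi>" for j
  proof -
    have *: "cutoff j p * ?g p = snd n * (indicator half p * dx (\<lambda>p. cutoff j p * \<psi> p) p)
        - fst n * (indicator half p * dy (\<lambda>p. cutoff j p * \<psi> p) p)" for p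
      unfolding smooth_dx_mult[OF smooth_cutoff test_smooth[OF assms]] dx_cutoff dy_cutoff
      by (simp add: algebra_simps)
    have "integrable lebesgue (\<lambda>p. indicator half p * dx (\<lambda>p. cutoff j p * \<psi> p) p)"
      "integrable lebesgue (\<lambda>p. indicator half p * dy (\<lambda>p. cutoff j p * \<psi> p) p)"
      using assms by (intro integrable_half_test test_dx test_dy test_mult smooth_cutoff; simp)+
    then have "(LINT p|lebesgue. cutoff j p * ?g p) = snd n * flux_x (\<lambda>p. cutoff j p * \<psi> p) - fst n * flux_y (\<lambda>p. cutoff j p * \<psi> p)"
      unfolding * flux_x_def flux_y_def by simp
    then show ?thesis using flux_cutoff[OF assms] by simp
  qed
  ultimately have "(\<lambda>j::nat. snd n * flux_x \<psi> - fst n * flux_y \<psi>) \<longlonglongrightarrow> 0"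
    using cutoff_integral_tendsto_0[of ?g] by simp
  then have "snd n * flux_x \<psi> = fst n * flux_y \<psi>" by (simp add: LIMSEQ_const_iff)
  then have "flux_x \<psi> * (fst n * fst n + snd n * snd n) = fst n * flux_n \<psi>"
    "flux_y \<psi> * (fst n * fst n + snd n * snd n) = snd n * flux_n \<psi>"
    by (simp_all add: flux_n_def algebra_simps)
  then show "flux_x \<psi> = fst n * flux_n \<psi>" "flux_y \<psi> = snd n * flux_n \<psi>"
    by (simp_all add: n_sq)
qed

lemma flux_n_eq:
  assumes "\<psi> \<in> test_functions W"
  shows "flux_n \<psi> = (LINT p|lebesgue. indicator half p * (fst n * dx \<psi> p + snd n * dy \<psi> p))"
proof -
  have int: "integrable lebesgue (\<lambda>p. indicator half p * dx \<psi> p)" "integrable lebesgue (\<lambda>p. indicator half p * dy \<psi> p)"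
    using assms by (intro integrable_half_test test_dx test_dy; simp)+
  have "(\<lambda>p. indicator half p * (fst n * dx \<psi> p + snd n * dy \<psi> p)) =
    (\<lambda>p. fst n * (indicator half p * dx \<psi> p) + snd n * (indicator half p * dy \<psi> p))"
    by (auto simp: fun_eq_iff algebra_simps)
  then show ?thesis using int by (simp add: flux_n_def flux_x_def flux_y_def)
qed

lemma flux_n_linear:
  assumes "\<phi> \<in> test_functions W" "\<psi> \<in> test_functions W"
  shows "flux_n (\<lambda>p. a * \<phi> p + b * \<psi> p) = a * flux_n \<phi> + b * flux_n \<psi>"
proof -
  note s = smooth_const[of a] smooth_const[of b] test_smooth[OF assms(1)] test_smooth[OF assms(2)]
  have D: "dx (\<lambda>p. a * \<phi> p + b * \<psi> p) = (\<lambda>p. a * dx \<phi> p + b * dx \<psi> p)"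
    "dy (\<lambda>p. a * \<phi> p + b * \<psi> p) = (\<lambda>p. a * dy \<phi> p + b * dy \<psi> p)"
    using s by (simp_all add: smooth_dx_add smooth_dx_mult smooth_mult dx_const)
  have int: "integrable lebesgue (\<lambda>p. indicator half p * dx \<phi> p)" "integrable lebesgue (\<lambda>p. indicator half p * dy \<phi> p)"
    "integrable lebesgue (\<lambda>p. indicator half p * dx \<psi> p)" "integrable lebesgue (\<lambda>p. indicator half p * dy \<psi> p)"
    using assms by (intro integrable_half_test test_dx test_dy; simp)+
  have e: "indicator half p * (a * u + b * v) = a * (indicator half p * u) + b * (indicator half p * v)" for p :: plane and u v :: real
    by (simp add: algebra_simps)
  show ?thesis unfolding flux_n_def flux_x_def flux_y_def D e using int by (simp add: algebra_simps)
qed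

text \<open>The witness is a radial bump times \<open>exp (-A (p \<bullet> n - c))\<close>. With \<open>A\<close> large, the normal derivative
  of its product with \<open>k\<close> is negative in the half disc, so no surface measure is needed.\<close>

lemma ex_test_flux_nonzero:
  assumes "p0 \<in> W" "p0 \<bullet> n = c" and k: "smooth k" "0 < k p0"
  shows "\<exists>\<phi>\<in>test_functions W. flux_n (\<lambda>p. k p * \<phi> p) \<noteq> 0"
proof -
  let ?D = "\<lambda>p. fst n * dx k p + snd n * dy k p"
  obtain r where r: "0 < r" "cball p0 r \<subseteq> W" using W assms(1) open_contains_cball by blast
  obtain d0 where d0: "0 < d0" "\<And>p. dist p p0 < d0 \<Longrightarrow> dist (k p) (k p0) < k p0 / 2"
    using smooth_continuous_on[OF k(1), of UNIV] k(2) unfolding continuous_on_iff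
    by (metis UNIV_I half_gt_zero)
  define d where "d = min r (d0 / 2)"
  have d: "0 < d" "cball p0 d \<subseteq> W" using r d0 by (auto simp: d_def)
  define m where "m = k p0 / 2"
  have m: "0 < m" "m \<le> k p" if "p \<in> cball p0 d" for p
    using d0(2)[of p] d0(1) that k(2) by (auto simp: d_def m_def dist_commute dist_real_def abs_if split: if_splits)
  have m0: "0 < m" using k by (simp add: m_def)
  have "continuous_on (cball p0 d) ?D"
    by (intro continuous_intros smooth_continuous_on smooth_dx smooth_dy k)
  then have "bounded (?D ` cball p0 d)"
    by (intro compact_imp_bounded compact_continuous_image compact_cball)
  then obtain M where M': "\<forall>p\<in>cball p0 d. norm (?D p) \<le> M"
    unfolding bounded_iff by auto
  then have M: "?D p \<le> M" if "p \<in> cball p0 d" for p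
    using that by fastforce
  have "p0 \<in> cball p0 d" using d by simp
  then have "0 \<le> M" using M' norm_ge_zero order_trans by blast
  \<comment> \<open>On the ball \<open>k\<close> is at least \<open>m\<close> and its normal
    derivative at most \<open>M\<close>, so this choice makes the normal derivative of
    \<open>k\<close> minus \<open>A * k\<close> at most -1.\<close>
  define A where "A = (M + 1) / m"
  have A: "A * m = M + 1" "0 \<le> A" using m0 \<open>0 \<le> M\<close> by (simp_all add: A_def)
  define u where "u p = d\<^sup>2 - (norm (p - p0))\<^sup>2" for p
  have "real_polynomial_function (\<lambda>p::plane. d\<^sup>2 - ((fst p - fst p0)\<^sup>2 + (snd p - snd p0)\<^sup>2))"
    by (intro real_polynomial_function.intros(3) real_polynomial_function_power real_polynomial_function_diff
        real_polynomial_function.intros(2) real_polynomial_function.intros(1) bounded_linear_fst bounded_linear_snd)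
  moreover have u_eq: "u = (\<lambda>p. d\<^sup>2 - ((fst p - fst p0)\<^sup>2 + (snd p - snd p0)\<^sup>2))"
    by (auto simp: u_def fun_eq_iff norm_prod_def)
  ultimately have u: "smooth u" by (simp add: smooth_real_polynomial)
  have u_pos: "0 < u p \<longleftrightarrow> p \<in> ball p0 d" for p
    using d(1) by (simp add: u_def dist_norm norm_minus_commute[of p0] not_le[symmetric] power_mono_iff)
  define \<eta> where "\<eta> p = flat_exp 1 (u p)" for p
  define E where "E p = exp (- A * (p \<bullet> n - c))" for p
  define \<phi> where "\<phi> p = \<eta> p * E p" for p
  have \<eta>: "smooth \<eta>" unfolding \<eta>_def[abs_def] by (intro smooth_flat_exp u)
  have E: "smooth E" unfolding E_def[abs_def]
    by (intro smooth_exp smooth_real_polynomial real_polynomial_function.intros(4) real_polynomial_function_diff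
        real_polynomial_function.intros(2) real_polynomial_function.intros(1) bounded_linear_inner_left)
  have \<eta>_pos: "0 < \<eta> p" if "p \<in> ball p0 d" for p
    using that u_pos by (simp add: \<eta>_def flat_exp_def)
  have \<eta>_0: "\<eta> p = 0" if "p \<notin> ball p0 d" for p
    using that u_pos by (simp add: \<eta>_def flat_exp_def)
  have "\<phi> p = 0" if "p \<notin> cball p0 d" for p
    using \<eta>_0[of p] that by (simp add: \<phi>_def)
  then have "{p. \<phi> p \<noteq> 0} \<subseteq> cball p0 d" by blast
  then have cl: "closure {p. \<phi> p \<noteq> 0} \<subseteq> cball p0 d" by (simp add: closure_minimal)
  then have "compact (closure {p. \<phi> p \<noteq> 0})"
    using compact_closure bounded_subset[OF bounded_cball] closure_subset by (metis (no_types, lifting) subset_trans)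
  moreover have "smooth \<phi>" unfolding \<phi>_def[abs_def] using \<eta> E by (rule smooth_mult)
  ultimately have \<phi>: "\<phi> \<in> test_functions W"
    using cl d(2) by (auto simp: test_functions_def smooth_def)
  define \<eta>' where "\<eta>' p = flat_exp [:0, 0, 1:] (u p)" for p
  have \<eta>'_0: "0 \<le> \<eta>' p" for p
    by (simp add: \<eta>'_def flat_exp_def)
  have dx_u: "dx u p = - 2 * (fst p - fst p0)" "dy u p = - 2 * (snd p - snd p0)" for p
  proof -
    have "(u has_derivative (\<lambda>h. (- 2 * (fst p - fst p0)) * fst h + (- 2 * (snd p - snd p0)) * snd h)) (at p)"
      unfolding u_eq by (auto intro!: derivative_eq_intros simp: fun_eq_iff algebra_simps)
    from has_derivative_dx_eq[OF this] show "dx u p = - 2 * (fst p - fst p0)" "dy u p = - 2 * (snd p - snd p0)" by auto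
  qed
  have deriv: "(flat_exp 1 has_real_derivative \<eta>' p) (at (u p))" for p
    using flat_exp_deriv[of 1 "u p"] by (simp add: \<eta>'_def)
  have D\<eta>: "dx \<eta> p = \<eta>' p * (- 2 * (fst p - fst p0))" "dy \<eta> p = \<eta>' p * (- 2 * (snd p - snd p0))" for p
    unfolding \<eta>_def[abs_def] using dx_compose[OF u deriv] dx_u by auto
  have DE: "dx E p = - A * fst n * E p" "dy E p = - A * snd n * E p" for p
  proof -
    have "(E has_derivative (\<lambda>h. (- A * fst n * E p) * fst h + (- A * snd n * E p) * snd h)) (at p)"
      unfolding E_def[abs_def] by (auto intro!: derivative_eq_intros simp: fun_eq_iff inner_prod_def algebra_simps)
    from has_derivative_dx_eq[OF this] show "dx E p = - A * fst n * E p" "dy E p = - A * snd n * E p" by auto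
  qed
  let ?\<psi> = "\<lambda>p. k p * \<phi> p"
  have \<psi>: "?\<psi> \<in> test_functions W" using k \<phi> by (intro test_mult)
  have D\<psi>: "fst n * dx ?\<psi> p + snd n * dy ?\<psi> p =
      E p * (?D p * \<eta> p - A * k p * \<eta> p - 2 * k p * \<eta>' p * (p \<bullet> n - c))" for p
  proof -
    have *: "dx ?\<psi> p = dx k p * (\<eta> p * E p) + k p * (dx \<eta> p * E p + \<eta> p * dx E p)"
      "dy ?\<psi> p = dy k p * (\<eta> p * E p) + k p * (dy \<eta> p * E p + \<eta> p * dy E p)"
      unfolding \<phi>_def[abs_def] using smooth_dx_mult[OF k(1) smooth_mult[OF \<eta> E]] smooth_dx_mult[OF \<eta> E] by simp_all
    \<comment> \<open>Because \<open>p0\<close> lies on the line, the derivative of \<open>u\<close>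
      in direction \<open>n\<close> is \<open>- 2 * (p \<bullet> n - c)\<close>, which is
      nonpositive in \<open>half\<close>.\<close>
    have s: "p \<bullet> n - c = (fst p - fst p0) * fst n + (snd p - snd p0) * snd n"
      using assms(2) by (simp add: inner_prod_def algebra_simps)
    show ?thesis unfolding * D\<eta> DE s using n_sq by algebra
  qed
  have le: "indicator half p * (fst n * dx ?\<psi> p + snd n * dy ?\<psi> p) \<le> - (indicator half p * \<phi> p)" for p
  proof (cases "p \<in> half \<and> p \<in> ball p0 d")
    case True
    then have s: "0 \<le> p \<bullet> n - c" and pb: "p \<in> cball p0 d" by (auto simp: half_def)
    have "M + 1 \<le> A * k p"
      using mult_left_mono[OF m(2)[OF pb] A(2)] A(1) by simp
    with M[OF pb] have "(?D p - A * k p) * \<eta> p \<le> - 1 * \<eta> p"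
      using True \<eta>_pos[of p] by (intro mult_right_mono) auto
    moreover have "0 \<le> 2 * k p * \<eta>' p * (p \<bullet> n - c)"
      using m[OF pb] \<eta>'_0 s by (intro mult_nonneg_nonneg) auto
    ultimately have "?D p * \<eta> p - A * k p * \<eta> p - 2 * k p * \<eta>' p * (p \<bullet> n - c) \<le> - \<eta> p"
      by (simp add: algebra_simps)
    then have "E p * (?D p * \<eta> p - A * k p * \<eta> p - 2 * k p * \<eta>' p * (p \<bullet> n - c)) \<le> E p * (- \<eta> p)"
      by (rule mult_left_mono) (simp add: E_def)
    then show ?thesis using True unfolding D\<psi> by (simp add: \<phi>_def mult.commute)
  next
    case False
    have "\<eta> p = 0 \<and> \<eta>' p = 0" if "p \<notin> ball p0 d"
      using that u_pos \<eta>_0 by (simp add: \<eta>'_def flat_exp_def)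
    then show ?thesis using False unfolding D\<psi> by (auto simp: \<phi>_def)
  qed
  have int_\<phi>: "integrable lebesgue (\<lambda>p. indicator half p * \<phi> p)"
    by (rule integrable_half_test[OF \<phi>])
  have \<phi>_nonneg: "0 \<le> indicator half p * \<phi> p" for p
    by (cases "p \<in> ball p0 d") (auto simp: \<phi>_def E_def less_imp_le \<eta>_pos \<eta>_0)
  have "flux_n ?\<psi> \<le> (LINT p|lebesgue. - (indicator half p * \<phi> p))"
    unfolding flux_n_eq[OF \<psi>]
  proof (rule integral_mono)
    have "integrable lebesgue (\<lambda>p. fst n * (indicator half p * dx ?\<psi> p) + snd n * (indicator half p * dy ?\<psi> p))"
      using integrable_half_test[OF test_dx[OF \<psi>]] integrable_half_test[OF test_dy[OF \<psi>]]
      by (intro Bochner_Integration.integrable_add integrable_mult_right)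
    then show "integrable lebesgue (\<lambda>p. indicator half p * (fst n * dx ?\<psi> p + snd n * dy ?\<psi> p))"
      by (simp add: algebra_simps)
  qed (use int_\<phi> le in auto)
  \<comment> \<open>This gives strictness: otherwise \<open>\<phi>\<close> would vanish almost
    everywhere in a nonempty open half disc, where it is positive.\<close>
  moreover have "(LINT p|lebesgue. indicator half p * \<phi> p) \<noteq> 0"
  proof
    assume "(LINT p|lebesgue. indicator half p * \<phi> p) = 0"
    then have "AE p in lebesgue. indicator half p * \<phi> p = 0"
      using integral_nonneg_eq_0_iff_AE[OF int_\<phi>] \<phi>_nonneg by simp
    then have "AE p in lebesgue. p \<notin> ball p0 d \<inter> {p. c < p \<bullet> n}"
    proof eventually_elim
      case (elim p)
      then show ?case using \<eta>_pos[of p] by (auto simp: half_def \<phi>_def E_def)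
    qed
    moreover have op: "open (ball p0 d \<inter> {p. c < p \<bullet> n})"
      by (intro open_Int open_ball open_Collect_less continuous_intros)
    ultimately have "negligible (ball p0 d \<inter> {p. c < p \<bullet> n})"
      by (simp add: negligible_iff_null_sets AE_iff_null_sets borel_open lebesgue_openin)
    moreover have "p0 + (d / 2) *\<^sub>R n \<in> ball p0 d \<inter> {p. c < p \<bullet> n}"
      using d(1) norm_n assms(2) norm_eq_1[of n] by (simp add: dist_norm inner_add_left)
    ultimately show False using op open_not_negligible by blast
  qed
  moreover have "0 \<le> (LINT p|lebesgue. indicator half p * \<phi> p)"
    using \<phi>_nonneg by simp
  ultimately have "flux_n ?\<psi> < 0" by simp
  then show ?thesis using \<phi> by (intro bexI[of _ \<phi>]) auto
qed

text \<open>A measure on the line that is also given by a function must be 0: replacing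
  \<open>\<phi>\<close> by \<open>cutoff j p * \<phi> p\<close> leaves the flux unchanged, while the
  integral over the plane tends to 0. The density \<open>k\<close> is the normal component of
  \<open>(a, b)\<close>, and a bump at \<open>p0\<close> detects its value.\<close>

lemma trace_vanishes:
  assumes ab: "smooth a" "smooth b"
    and int: "\<And>\<phi>. \<phi> \<in> test_functions W \<Longrightarrow> integrable lebesgue (\<lambda>p. g p * \<phi> p)"
    and eq: "\<And>\<phi>. \<phi> \<in> test_functions W \<Longrightarrow>
      flux_x (\<lambda>p. a p * \<phi> p) + flux_y (\<lambda>p. b p * \<phi> p) = (LINT p|lebesgue. g p * \<phi> p)"
    and p0: "p0 \<in> W" "p0 \<bullet> n = c"
  shows "fst n * a p0 + snd n * b p0 = 0"
proof -
  define k where "k p = fst n * a p + snd n * b p" for p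
  have k: "smooth k" unfolding k_def[abs_def] using ab by (intro smooth_add smooth_mult smooth_const)
  have Tk: "flux_n (\<lambda>p. k p * \<phi> p) = (LINT p|lebesgue. g p * \<phi> p)" if "\<phi> \<in> test_functions W" for \<phi>
  proof -
    have t: "(\<lambda>p. a p * \<phi> p) \<in> test_functions W" "(\<lambda>p. b p * \<phi> p) \<in> test_functions W"
      using ab that by (auto intro: test_mult)
    have "(\<lambda>p. k p * \<phi> p) = (\<lambda>p. fst n * (a p * \<phi> p) + snd n * (b p * \<phi> p))"
      by (simp add: k_def algebra_simps)
    then show ?thesis
      using eq[OF that] flux_tangential(1)[OF t(1)] flux_tangential(2)[OF t(2)] flux_n_linear[OF t] by simp
  qed
  have T0: "flux_n (\<lambda>p. k p * \<phi> p) = 0" if \<phi>: "\<phi> \<in> test_functions W" for \<phi>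
  proof -
    have "flux_n (\<lambda>p. k p * \<phi> p) = (LINT p|lebesgue. cutoff j p * (g p * \<phi> p))" for j
    proof -
      have "flux_n (\<lambda>p. k p * \<phi> p) = flux_n (\<lambda>p. cutoff j p * (k p * \<phi> p))"
        using flux_cutoff[OF test_mult[OF k \<phi>]] by (simp add: flux_n_def)
      also have "\<dots> = flux_n (\<lambda>p. k p * (cutoff j p * \<phi> p))" by (simp add: mult.left_commute)
      also have "\<dots> = (LINT p|lebesgue. g p * (cutoff j p * \<phi> p))"
        by (rule Tk[OF test_mult[OF smooth_cutoff \<phi>]])
      finally show ?thesis by (simp add: mult.left_commute)
    qed
    then have "(\<lambda>j::nat. flux_n (\<lambda>p. k p * \<phi> p)) \<longlonglongrightarrow> 0"
      using cutoff_integral_tendsto_0[OF int[OF \<phi>]] by simp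
    then show ?thesis by (simp add: LIMSEQ_const_iff)
  qed
  have "k p0 = 0"
  proof (rule ccontr)
    assume "k p0 \<noteq> 0"
    \<comment> \<open>Multiplying \<open>k\<close> by the constant \<open>k p0\<close> produces the
      positive sign that the bump construction requires.\<close>
    then have "0 < k p0 * k p0" by (auto simp: zero_less_mult_iff)
    then obtain \<phi> where \<phi>: "\<phi> \<in> test_functions W" "flux_n (\<lambda>p. (k p0 * k p) * \<phi> p) \<noteq> 0"
      using ex_test_flux_nonzero[OF p0 smooth_mult[OF smooth_const k]] by blast
    have "(\<lambda>p. (k p0 * k p) * \<phi> p) = (\<lambda>p. k p * (k p0 * \<phi> p))" by (simp add: algebra_simps)
    then show False using \<phi> T0[OF test_mult[OF smooth_const \<phi>(1)]] by simp
  qed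
  then show ?thesis by (simp add: k_def)
qed

text \<open>Taking \<open>(f - g, 0)\<close> and \<open>(0, f - g)\<close> as the pair in
  \<open>trace_vanishes\<close> gives both components of the jump times \<open>n\<close>, and
  \<open>n\<close> is not zero. In this sign convention \<open>u\<close> and \<open>v\<close> are
  minus the weak partial derivatives.\<close>

lemma weak_gradient_imp_no_jump:
  assumes f: "smooth f" "smooth g"
    and u: "\<And>\<phi>. \<phi> \<in> test_functions W \<Longrightarrow> integrable lebesgue (\<lambda>p. u p * \<phi> p)"
      "\<And>\<phi>. \<phi> \<in> test_functions W \<Longrightarrow> (LINT p|lebesgue. glue half f g p * dx \<phi> p) = (LINT p|lebesgue. u p * \<phi> p)"
    and v: "\<And>\<phi>. \<phi> \<in> test_functions W \<Longrightarrow> integrable lebesgue (\<lambda>p. v p * \<phi> p)"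
      "\<And>\<phi>. \<phi> \<in> test_functions W \<Longrightarrow> (LINT p|lebesgue. glue half f g p * dy \<phi> p) = (LINT p|lebesgue. v p * \<phi> p)"
    and p0: "p0 \<in> W" "p0 \<bullet> n = c"
  shows "f p0 = g p0"
proof -
  have fg: "smooth (\<lambda>p. f p - g p)" using f by (rule smooth_diff)
  have T0: "flux_x (\<lambda>p. 0 * \<phi> p) = 0" "flux_y (\<lambda>p. 0 * \<phi> p) = 0" for \<phi>
    by (simp_all add: flux_x_def flux_y_def dx_const)
  have "fst n * (f p0 - g p0) + snd n * 0 = 0"
  proof (rule trace_vanishes[where g = "\<lambda>p. u p + glue half (dx f) (dx g) p", OF fg smooth_const _ _ p0])
    fix \<phi> assume \<phi>: "\<phi> \<in> test_functions W"
    note int = u(1)[OF \<phi>] integrable_glue_test[OF half_borel smooth_dx[OF f(1)] smooth_dx[OF f(2)] \<phi>]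
    show "integrable lebesgue (\<lambda>p. (u p + glue half (dx f) (dx g) p) * \<phi> p)"
      unfolding distrib_right using int by simp
    show "flux_x (\<lambda>p. (f p - g p) * \<phi> p) + flux_y (\<lambda>p. 0 * \<phi> p) =
        (LINT p|lebesgue. (u p + glue half (dx f) (dx g) p) * \<phi> p)"
      unfolding distrib_right T0 Bochner_Integration.integral_add[OF int]
      using glue_integral_by_parts_jump(1)[OF f \<phi>] u(2)[OF \<phi>] by simp
  qed
  moreover have "fst n * 0 + snd n * (f p0 - g p0) = 0"
  proof (rule trace_vanishes[where g = "\<lambda>p. v p + glue half (dy f) (dy g) p", OF smooth_const fg _ _ p0])
    fix \<phi> assume \<phi>: "\<phi> \<in> test_functions W"
    note int = v(1)[OF \<phi>] integrable_glue_test[OF half_borel smooth_dy[OF f(1)] smooth_dy[OF f(2)] \<phi>]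
    show "integrable lebesgue (\<lambda>p. (v p + glue half (dy f) (dy g) p) * \<phi> p)"
      unfolding distrib_right using int by simp
    show "flux_x (\<lambda>p. 0 * \<phi> p) + flux_y (\<lambda>p. (f p - g p) * \<phi> p) =
        (LINT p|lebesgue. (v p + glue half (dy f) (dy g) p) * \<phi> p)"
      unfolding distrib_right T0 Bochner_Integration.integral_add[OF int]
      using glue_integral_by_parts_jump(2)[OF f \<phi>] v(2)[OF \<phi>] by simp
  qed
  ultimately show ?thesis using n_sq by auto
qed

text \<open>The line is parametrised with tangent \<open>(- snd n, fst n)\<close>. Vanishing of
  \<open>q\<close> is known only inside \<open>W\<close>, hence the passage to the open preimage of
  \<open>W\<close> around parameter 0.\<close>

lemma tangential_derivative_zero:
  assumes "smooth q" "\<And>p. p \<in> W \<Longrightarrow> p \<bullet> n = c \<Longrightarrow> q p = 0" "p0 \<in> W" "p0 \<bullet> n = c"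
  shows "fst n * dy q p0 = snd n * dx q p0"
proof -
  let ?\<gamma> = "\<lambda>t::real. p0 + t *\<^sub>R (- snd n, fst n)"
  have "(?\<gamma> has_derivative (\<lambda>h. h *\<^sub>R (- snd n, fst n))) (at 0)"
    by (auto intro!: derivative_eq_intros)
  moreover have "(q has_derivative (\<lambda>h. dx q p0 * fst h + dy q p0 * snd h)) (at (?\<gamma> 0))"
    using smooth_has_derivative[OF assms(1), of p0] by (simp add: zero_prod_def[symmetric])
  ultimately have "((\<lambda>t. q (?\<gamma> t)) has_derivative
      (\<lambda>h. dx q p0 * fst (h *\<^sub>R (- snd n, fst n)) + dy q p0 * snd (h *\<^sub>R (- snd n, fst n)))) (at 0)"
    by (rule has_derivative_compose)
  then have D: "((\<lambda>t. q (?\<gamma> t)) has_derivative (\<lambda>h. (fst n * dy q p0 - snd n * dx q p0) * h)) (at 0)"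
    by (simp add: algebra_simps)
  have "open (?\<gamma> -` W)"
    using W by (intro open_vimage continuous_intros) auto
  then have "((\<lambda>t. 0) has_derivative (\<lambda>h. (fst n * dy q p0 - snd n * dx q p0) * h)) (at (0::real))"
    by (rule has_derivative_transform_within_open[OF D])
      (use assms(2-4) in \<open>auto simp: inner_add_left inner_prod_def algebra_simps zero_prod_def[symmetric]\<close>)
  then have "((\<lambda>t. 0) has_real_derivative (fst n * dy q p0 - snd n * dx q p0)) (at 0)"
    by (simp add: has_field_derivative_def)
  then have "fst n * dy q p0 - snd n * dx q p0 = 0" by (rule DERIV_unique) simp
  then show ?thesis by simp
qed

text \<open>The first integration by parts has no boundary term by \<open>fg\<close>; the second one
  produces the flux of the pair formed by the jump of \<open>dx\<close> and minus the jump of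
  \<open>dy\<close>, to which \<open>trace_vanishes\<close> applies.\<close>

lemma weak_wave_imp_no_gradient_jump:
  assumes f: "smooth f" "smooth g"
    and fg: "\<And>p. p \<in> W \<Longrightarrow> p \<bullet> n = c \<Longrightarrow> f p = g p"
    and u: "\<And>\<phi>. \<phi> \<in> test_functions W \<Longrightarrow> integrable lebesgue (\<lambda>p. u p * \<phi> p)"
      "\<And>\<phi>. \<phi> \<in> test_functions W \<Longrightarrow>
        (LINT p|lebesgue. glue half f g p * dx (dx \<phi>) p) - (LINT p|lebesgue. glue half f g p * dy (dy \<phi>) p)
        = (LINT p|lebesgue. u p * \<phi> p)"
    and p0: "p0 \<in> W" "p0 \<bullet> n = c" and n: "(fst n)\<^sup>2 \<noteq> (snd n)\<^sup>2"
  shows "dx f p0 = dx g p0" "dy f p0 = dy g p0"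
proof -
  let ?q = "\<lambda>p. f p - g p"
  let ?a = "\<lambda>p. dx f p - dx g p" and ?b = "\<lambda>p. dy f p - dy g p"
  have D: "dx ?q = ?a" "dy ?q = ?b" using f by (simp_all add: smooth_dx_diff)
  have ab: "smooth ?a" "smooth ?b" using f by (auto intro!: smooth_diff smooth_dx smooth_dy)
  have fg': "f p = g p" if "p \<in> W \<inter> half \<inter> {p. p \<bullet> n \<le> c}" for p
    using fg[of p] that by (auto simp: half_def)
  let ?X = "glue half (dx (dx f)) (dx (dx g))" and ?Y = "glue half (dy (dy f)) (dy (dy g))"
  have "fst n * ?a p0 + snd n * (- ?b p0) = 0"
  proof (rule trace_vanishes[where g = "\<lambda>p. ?X p - ?Y p - u p", OF ab(1) smooth_minus[OF ab(2)] _ _ p0])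
    fix \<phi> assume \<phi>: "\<phi> \<in> test_functions W"
    note ints = integrable_glue_test[OF half_borel smooth_dx[OF smooth_dx[OF f(1)]] smooth_dx[OF smooth_dx[OF f(2)]] \<phi>]
      integrable_glue_test[OF half_borel smooth_dy[OF smooth_dy[OF f(1)]] smooth_dy[OF smooth_dy[OF f(2)]] \<phi>] u(1)[OF \<phi>]
    show "integrable lebesgue (\<lambda>p. (?X p - ?Y p - u p) * \<phi> p)"
      unfolding left_diff_distrib using ints by simp
    have m: "flux_y (\<lambda>p. - ?b p * \<phi> p) = - flux_y (\<lambda>p. ?b p * \<phi> p)"
      using smooth_dx_minus(2)[OF smooth_mult[OF ab(2) test_smooth[OF \<phi>]]]
      by (simp add: flux_y_def del: minus_diff_eq)
    have "(LINT p|lebesgue. glue half f g p * dx (dx \<phi>) p) = - (LINT p|lebesgue. glue half (dx f) (dx g) p * dx \<phi> p)"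
      "(LINT p|lebesgue. glue half f g p * dy (dy \<phi>) p) = - (LINT p|lebesgue. glue half (dy f) (dy g) p * dy \<phi> p)"
      using integral_by_parts_glue(1)[OF f fg' test_dx[OF \<phi>]] integral_by_parts_glue(2)[OF f fg' test_dy[OF \<phi>]]
      by auto
    then show "flux_x (\<lambda>p. ?a p * \<phi> p) + flux_y (\<lambda>p. - ?b p * \<phi> p) = (LINT p|lebesgue. (?X p - ?Y p - u p) * \<phi> p)"
      unfolding left_diff_distrib m
      using glue_integral_by_parts_jump(1)[OF smooth_dx[OF f(1)] smooth_dx[OF f(2)] \<phi>]
        glue_integral_by_parts_jump(2)[OF smooth_dy[OF f(1)] smooth_dy[OF f(2)] \<phi>] u(2)[OF \<phi>] ints
      by (simp add: left_diff_distrib)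
  qed
  moreover have "fst n * ?b p0 = snd n * ?a p0"
    using tangential_derivative_zero[OF smooth_diff[OF f] _ p0] fg unfolding D by simp
  \<comment> \<open>The relations are n1 a = n2 b and n1 b = n2 a; eliminating one unknown leaves
    the determinant times the other.\<close>
  ultimately have "((fst n)\<^sup>2 - (snd n)\<^sup>2) * ?a p0 = 0" "((fst n)\<^sup>2 - (snd n)\<^sup>2) * ?b p0 = 0"
    by algebra+
  then show "dx f p0 = dx g p0" "dy f p0 = dy g p0" using n by auto
qed

end

subsection \<open>Two regions with a common segment\<close>

definition to_complex :: "plane \<Rightarrow> complex" where
  "to_complex p = Complex (fst p) (snd p)"

lemma linear_to_complex: "linear to_complex"
  by (rule linearI) (auto simp: to_complex_def complex_eq_iff)

lemma bij_to_complex: "bij to_complex"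
  by (rule bij_betw_byWitness[where f' = "\<lambda>z. (Re z, Im z)"]) (auto simp: to_complex_def)

lemma norm_to_complex: "norm (to_complex p) = norm p"
  by (simp add: to_complex_def norm_prod_def cmod_def)

lemma homeomorphism_to_complex: "homeomorphism UNIV UNIV to_complex (\<lambda>z. (Re z, Im z))"
proof (rule homeomorphismI)
  show "continuous_on UNIV to_complex"
    by (simp add: linear_continuous_on linear_conv_bounded_linear[symmetric] linear_to_complex)
  show "continuous_on UNIV (\<lambda>z. (Re z, Im z))"
    by (intro continuous_intros)
qed (simp_all add: to_complex_def)

lemma bounded_to_complex_image: "bounded (to_complex ` S) \<longleftrightarrow> bounded S"
  by (simp add: bounded_iff norm_to_complex)

text \<open>\<open>inside\<close> collects the bounded components of the complement. A homeomorphism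
  of complements maps components to components, and an isometry preserves boundedness.\<close>

lemma inside_to_complex_image: "inside (to_complex ` S) = to_complex ` inside S"
proof -
  have hom: "homeomorphism (- S) (- (to_complex ` S)) to_complex (\<lambda>z. (Re z, Im z))"
    using homeomorphism_of_subsets[OF homeomorphism_to_complex, of "- S"] bij_image_Compl_eq[OF bij_to_complex] by simp
  have "to_complex x \<in> inside (to_complex ` S) \<longleftrightarrow> x \<in> inside S" for x
  proof (cases "x \<in> S")
    case False
    then have "connected_component_set (- (to_complex ` S)) (to_complex x) = to_complex ` connected_component_set (- S) x"
      using connected_component_set_homeomorphism[OF hom] by simp
    moreover have "to_complex x \<notin> to_complex ` S"
      using False bij_to_complex by (simp add: bij_is_inj inj_image_mem_iff)
    ultimately show ?thesis using False by (simp add: inside_def bounded_to_complex_image)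
  qed (simp add: inside_def)
  then have "z \<in> inside (to_complex ` S) \<longleftrightarrow> z \<in> to_complex ` inside S" for z
    by (metis bij_to_complex bij_is_inj bij_is_surj inj_image_mem_iff surjD)
  then show ?thesis by blast
qed

lemma frontier_to_complex_image: "frontier (to_complex ` S) = to_complex ` frontier S"
  using linear_to_complex bij_to_complex
  by (simp add: frontier_def closure_injective_linear_image interior_bijective_linear_image
      image_set_diff bij_is_inj)

lemma Jordan_plane:
  fixes \<gamma> :: "real \<Rightarrow> plane"
  assumes "simple_path \<gamma>" "pathfinish \<gamma> = pathstart \<gamma>"
  defines "J \<equiv> path_image \<gamma>"
  shows "inside J \<noteq> {}" "open (inside J)" "bounded (inside J)" "outside J \<noteq> {}" "open (outside J)"
    "inside J \<inter> outside J = {}" "inside J \<union> outside J = - J"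
    "frontier (inside J) = J" "frontier (outside J) = J" "compact J"
proof -
  have inj: "inj to_complex" using bij_to_complex by (rule bij_is_inj)
  have "simple_path (to_complex \<circ> \<gamma>)"
    using assms(1) simple_path_linear_image_eq[OF linear_to_complex inj] by simp
  moreover have "pathfinish (to_complex \<circ> \<gamma>) = pathstart (to_complex \<circ> \<gamma>)"
    using assms(2) by (simp add: pathfinish_compose pathstart_compose)
  moreover have img: "path_image (to_complex \<circ> \<gamma>) = to_complex ` J"
    by (simp add: path_image_compose J_def)
  ultimately have *: "inside (to_complex ` J) \<noteq> {}" "open (inside (to_complex ` J))"
      "bounded (inside (to_complex ` J))" "frontier (inside (to_complex ` J)) = to_complex ` J"
      "outside (to_complex ` J) \<noteq> {}" "frontier (outside (to_complex ` J)) = to_complex ` J"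
    using Jordan_inside_outside[of "to_complex \<circ> \<gamma>"] by auto
  have out: "outside (to_complex ` J) = to_complex ` outside J"
    unfolding outside_inside inside_to_complex_image image_Un[symmetric]
    by (rule bij_image_Compl_eq[OF bij_to_complex, symmetric])
  show "inside J \<noteq> {}" "bounded (inside J)" "outside J \<noteq> {}"
    using * unfolding inside_to_complex_image out by (auto simp: bounded_to_complex_image)
  show "frontier (inside J) = J" "frontier (outside J) = J"
    using *(4,6) unfolding inside_to_complex_image out frontier_to_complex_image
    by (simp_all add: inj_image_eq_iff[OF inj])
  show J: "compact J" using assms by (simp add: compact_simple_path_image)
  then show "open (inside J)" "open (outside J)"
    by (simp_all add: compact_imp_closed open_inside open_outside)
  show "inside J \<inter> outside J = {}" "inside J \<union> outside J = - J"
    by (auto simp: inside_Int_outside inside_Un_outside)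
qed

definition is_jordan_curve :: "plane set \<Rightarrow> bool" where
  "is_jordan_curve J \<longleftrightarrow> (\<exists>\<gamma>. simple_path \<gamma> \<and> pathfinish \<gamma> = pathstart \<gamma> \<and> path_image \<gamma> = J)"

lemma jordanD:
  assumes "is_jordan_curve J"
  shows "inside J \<noteq> {}" "open (inside J)" "bounded (inside J)" "outside J \<noteq> {}" "open (outside J)"
    "inside J \<inter> outside J = {}" "inside J \<union> outside J = - J"
    "frontier (inside J) = J" "frontier (outside J) = J" "compact J"
proof -
  obtain \<gamma> where \<gamma>: "simple_path \<gamma>" "pathfinish \<gamma> = pathstart \<gamma>" and J: "path_image \<gamma> = J"
    using assms unfolding is_jordan_curve_def by blast
  show "inside J \<noteq> {}" "open (inside J)" "bounded (inside J)" "outside J \<noteq> {}" "open (outside J)"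
    "inside J \<inter> outside J = {}" "inside J \<union> outside J = - J"
    "frontier (inside J) = J" "frontier (outside J) = J" "compact J"
    by (fact Jordan_plane[OF \<gamma>, unfolded J])+
qed

text \<open>The region is the complement of \<open>outside J\<close>, an open set with frontier
  \<open>J\<close>; everything is read off from there. The last claim later prevents a region from
  filling a neighbourhood of a point of its own curve.\<close>

lemma jordan_region:
  assumes "is_jordan_curve J"
  defines "R \<equiv> J \<union> inside J"
  shows "closed R" "bounded R" "frontier R = J" "J \<subseteq> closure (- R)"
proof -
  have R: "R = - outside J" by (simp add: R_def outside_inside)
  show "closed R" using jordanD(5)[OF assms(1)] by (simp add: R closed_def)
  show "bounded R" using jordanD(3,10)[OF assms(1)] by (simp add: R_def compact_imp_bounded)
  show "frontier R = J" using jordanD(9)[OF assms(1)] by (simp add: R frontier_complement)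
  show "J \<subseteq> closure (- R)" using jordanD(9)[OF assms(1)] by (auto simp: R frontier_def)
qed

text \<open>This excludes that the common edge lies on a slit of \<open>\<Omega>\<close>, where nothing would be known about
  the jumps.\<close>

lemma interior_closure_domain:
  assumes "bounded_domain \<Omega>" "piecewise_smooth_boundary \<Omega>"
  shows "interior (closure \<Omega>) \<subseteq> \<Omega>"
proof
  fix p assume p: "p \<in> interior (closure \<Omega>)"
  show "p \<in> \<Omega>"
  proof (rule ccontr)
    assume "p \<notin> \<Omega>"
    have \<Omega>: "open \<Omega>" "connected \<Omega>" using assms(1) by (auto simp: bounded_domain_def)
    from p \<open>p \<notin> \<Omega>\<close> \<Omega>(1) have "p \<in> frontier \<Omega>"
      using interior_subset by (auto simp: frontier_def interior_open)
    moreover obtain \<Gamma> where \<Gamma>: "frontier \<Omega> = (\<Union>\<gamma>\<in>\<Gamma>. path_image \<gamma>)"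
      "\<And>\<gamma>. \<gamma> \<in> \<Gamma> \<Longrightarrow> simple_path \<gamma> \<and> pathfinish \<gamma> = pathstart \<gamma>"
      using assms(2) unfolding piecewise_smooth_boundary_def by metis
    ultimately obtain \<gamma> where \<gamma>: "\<gamma> \<in> \<Gamma>" "p \<in> path_image \<gamma>" by blast
    define J where "J = path_image \<gamma>"
    have J: "is_jordan_curve J" "p \<in> J" "J \<subseteq> frontier \<Omega>"
      using \<gamma> \<Gamma> unfolding J_def is_jordan_curve_def by blast+
    have dis: "\<Omega> \<inter> J = {}" using J(3) \<Omega>(1) by (auto simp: frontier_def interior_open)
    \<comment> \<open>Being connected and disjoint from \<open>J\<close>, the domain lies on one
      side of it. The other side is open, misses the domain and accumulates at \<open>p\<close>,
      although \<open>p\<close> is interior to the closure of the domain.\<close>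
    have "\<Omega> \<subseteq> inside J \<union> outside J" using dis unfolding jordanD(7)[OF J(1)] by auto
    then have "inside J \<inter> \<Omega> = {} \<or> outside J \<inter> \<Omega> = {}"
      using connectedD[OF \<Omega>(2) jordanD(2,5)[OF J(1)]] jordanD(6)[OF J(1)] by (metis inf_bot_left)
    moreover have "p \<in> closure (inside J)" "p \<in> closure (outside J)"
      using jordanD(8,9)[OF J(1)] J(2) by (auto simp: frontier_def)
    ultimately have "\<exists>U. open U \<and> p \<in> closure U \<and> U \<inter> \<Omega> = {}"
      using jordanD(2)[OF J(1)] jordanD(5)[OF J(1)] by metis
    then obtain U where U: "open U" "p \<in> closure U" "U \<inter> \<Omega> = {}" by blast
    then have "U \<inter> closure \<Omega> = {}" by (simp add: open_Int_closure_eq_empty)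
    then have "U \<inter> interior (closure \<Omega>) = {}" using interior_subset by blast
    then show False
      using U(2) p open_Int_closure_eq_empty[OF open_interior[of "closure \<Omega>"], of U] by blast
  qed
qed

section \<open>Triangles and their common edge\<close>

lemma triangle_jordan:
  assumes "is_triangle \<Omega> K"
  shows "is_jordan_curve (\<Union>K)"
proof -
  obtain a b c e1 e2 e3 where t: "is_side \<Omega> a b e1" "is_side \<Omega> b c e2" "is_side \<Omega> c a e3"
     "e1 \<inter> e2 = {b}" "e2 \<inter> e3 = {c}" "e3 \<inter> e1 = {a}" "K = {e1, e2, e3}"
    using assms unfolding is_triangle_def by auto
  obtain g1 g2 g3 where g: "arc g1" "pathstart g1 = a" "pathfinish g1 = b" "path_image g1 = e1"
    "arc g2" "pathstart g2 = b" "pathfinish g2 = c" "path_image g2 = e2"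
    "arc g3" "pathstart g3 = c" "pathfinish g3 = a" "path_image g3 = e3"
    using t(1-3) unfolding is_side_def by metis
  have a23: "arc (g2 +++ g3)" using g t by (intro arc_join) auto
  have "simple_path (g1 +++ (g2 +++ g3))"
    using g t a23 by (intro simple_path_join_loop) (auto simp: path_image_join)
  moreover have "path_image (g1 +++ (g2 +++ g3)) = \<Union>K"
    using g t by (auto simp: path_image_join)
  ultimately show ?thesis
    unfolding is_jordan_curve_def using g by (intro exI[of _ "g1 +++ (g2 +++ g3)"]) auto
qed

text \<open>The edge is given as an intersection of frontiers, and the same has to be shown for the
  regions. As \<open>e\<close> is infinite, conformity of the triangulation leaves only a common
  side; that side lies on both frontiers, hence in \<open>e\<close>.\<close>

lemma common_segment:
  assumes tri: "is_triangulation \<Omega> \<T>" and T: "T1 \<in> \<T>" "T2 \<in> \<T>"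
    and e: "e = frontier (region T1) \<inter> frontier (region T2)" "e = closed_segment a b" "a \<noteq> b"
  shows "region T1 \<inter> region T2 = e" "e \<subseteq> \<Union>T1" "e \<subseteq> \<Union>T2"
proof -
  have J: "is_jordan_curve (\<Union>T1)" "is_jordan_curve (\<Union>T2)"
    using tri T by (auto simp: is_triangulation_def intro: triangle_jordan)
  have fr: "frontier (region T1) = \<Union>T1" "frontier (region T2) = \<Union>T2"
    using jordan_region(3)[OF J(1)] jordan_region(3)[OF J(2)] by (simp_all only: region_def)
  show sub: "e \<subseteq> \<Union>T1" "e \<subseteq> \<Union>T2" using e(1) fr by auto
  have "infinite e" unfolding e(2) using e(3) by simp
  have "T1 \<noteq> T2"
  proof
    assume "T1 = T2"
    then have eJ: "e = \<Union>T1" using e(1) fr by simp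
    \<comment> \<open>A segment does not separate the plane, whereas a Jordan curve does; this rules
      out equal triangles.\<close>
    have "connected (- e)"
      using e(2) by (auto intro: connected_complement_bounded_convex simp: bounded_closed_segment)
    moreover have "inside (\<Union>T1) \<inter> outside (\<Union>T1) \<inter> - e = {}"
      "- e \<subseteq> inside (\<Union>T1) \<union> outside (\<Union>T1)"
      unfolding eJ using jordanD(6,7)[OF J(1)] by simp_all
    ultimately have "inside (\<Union>T1) \<inter> - e = {} \<or> outside (\<Union>T1) \<inter> - e = {}"
      using connectedD[OF _ jordanD(2,5)[OF J(1)]] by metis
    moreover have "inside (\<Union>T1) \<subseteq> - e" "outside (\<Union>T1) \<subseteq> - e"
      unfolding eJ using jordanD(7)[OF J(1)] by (metis sup_ge1, metis sup_ge2)
    ultimately show False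
      using jordanD(1,4)[OF J(1)] by (metis inf_absorb1)
  qed
  then have "region T1 \<inter> region T2 = {} \<or> (\<exists>p. region T1 \<inter> region T2 = {p}) \<or>
      (\<exists>e'\<in>T1 \<inter> T2. region T1 \<inter> region T2 = e')"
    using tri T unfolding is_triangulation_def by meson
  moreover have "e \<subseteq> region T1 \<inter> region T2" using sub by (auto simp: region_def)
  ultimately obtain e' where e': "e' \<in> T1" "e' \<in> T2" "region T1 \<inter> region T2 = e'"
    using \<open>infinite e\<close> by (metis IntE finite.emptyI finite_insert finite_subset)
  then have "e' \<subseteq> e" using e(1) fr by auto
  with e'(3) \<open>e \<subseteq> region T1 \<inter> region T2\<close> show "region T1 \<inter> region T2 = e" by blast
qed

text \<open>As sides on the boundary of \<open>\<Omega>\<close> may be curved, the local picture at the common edge is derived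
  from the Jordan curve theorem: each half disc is connected, hence lies in one of the two insides,
  and both insides are met because every point of a Jordan curve is a limit of exterior points.\<close>

lemma half_balls:
  fixes n :: plane
  assumes J: "is_jordan_curve J1" "is_jordan_curve J2"
    and R: "R1 = J1 \<union> inside J1" "R2 = J2 \<union> inside J2"
    and e: "R1 \<inter> R2 = e" "e \<subseteq> J1" "e \<subseteq> J2" "e \<subseteq> {p. p \<bullet> n = c}"
    and p: "p \<in> interior (R1 \<union> R2)" "p \<in> e" and n: "n \<noteq> 0"
  obtains r where "0 < r" "ball p r \<subseteq> interior (R1 \<union> R2)"
    "{x \<in> ball p r. c < x \<bullet> n} \<subseteq> R1 \<and> {x \<in> ball p r. x \<bullet> n < c} \<subseteq> R2 \<or>
     {x \<in> ball p r. c < x \<bullet> n} \<subseteq> R2 \<and> {x \<in> ball p r. x \<bullet> n < c} \<subseteq> R1"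
proof -
  let ?W = "interior (R1 \<union> R2)"
  obtain r where r: "0 < r" "ball p r \<subseteq> ?W" using p(1) open_contains_ball open_interior by blast
  note jr = jordan_region[OF J(1), folded R(1)] jordan_region[OF J(2), folded R(2)]
  have cover: "?W - e \<subseteq> inside J1 \<union> inside J2"
  proof
    fix x assume x: "x \<in> ?W - e"
    \<comment> \<open>A point of \<open>J\<close> in \<open>?W\<close> is a limit of points of
      \<open>?W\<close> outside \<open>R\<close>. These lie in the closed set \<open>R'\<close>, so
      the point itself lies in \<open>R \<inter> R'\<close>, that is, in \<open>e\<close>.\<close>
    have aux: "x \<notin> J" if "J \<subseteq> closure (- R)" "closed R'" "R \<inter> R' = e" "J \<subseteq> R" "?W \<subseteq> R \<union> R'" for J R R'
    proof
      assume "x \<in> J"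
      have "x \<in> closure (?W \<inter> - R)"
        using open_Int_closure_subset[of ?W "- R"] \<open>x \<in> J\<close> that(1) x by auto
      also have "\<dots> \<subseteq> R'" using that(2,5) by (intro closure_minimal) auto
      finally show False using that(3,4) \<open>x \<in> J\<close> x by auto
    qed
    have W: "?W \<subseteq> R1 \<union> R2" "?W \<subseteq> R2 \<union> R1" using interior_subset by auto
    have "x \<notin> J1" using aux[OF jr(4) jr(5) e(1) _ W(1)] R by auto
    moreover have "x \<notin> J2" using aux[OF jr(8) jr(1) _ _ W(2)] R e(1) by auto
    ultimately show "x \<in> inside J1 \<union> inside J2" using x W R by auto
  qed
  have op: "open (inside J1)" "open (inside J2)" using J jordanD by auto
  have disj: "inside J1 \<inter> inside J2 = {}"
    using e(1,2) R(1,2) inside_no_overlap[of J1] by blast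
  let ?P = "{x \<in> ball p r. c < x \<bullet> n}" and ?N = "{x \<in> ball p r. x \<bullet> n < c}"
  have P: "?P = ball p r \<inter> {x. n \<bullet> x > c}" and N: "?N = ball p r \<inter> {x. n \<bullet> x < c}"
    by (auto simp: inner_commute)
  have conn: "connected ?P" "connected ?N"
    unfolding P N by (intro convex_connected convex_Int convex_ball convex_halfspace_gt convex_halfspace_lt)+
  have sub: "?P \<subseteq> inside J1 \<union> inside J2" "?N \<subseteq> inside J1 \<union> inside J2"
    using cover r(2) e(4) by force+
  have c: "?P \<subseteq> inside J1 \<or> ?P \<subseteq> inside J2" "?N \<subseteq> inside J1 \<or> ?N \<subseteq> inside J2"
    using connectedD[OF conn(1) op] connectedD[OF conn(2) op] sub disj by blast+
  have pc: "p \<bullet> n = c" using p(2) e(4) by auto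
  have dense: "ball p r \<subseteq> closure (?P \<union> ?N)"
  proof -
    have "interior {x. n \<bullet> x = c} = {}" using n by (simp add: interior_hyperplane)
    then have "closure (- {x. n \<bullet> x = c}) = UNIV" by (simp add: closure_complement)
    then have "ball p r \<subseteq> closure (ball p r \<inter> - {x. n \<bullet> x = c})"
      using open_Int_closure_subset[of "ball p r" "- {x. n \<bullet> x = c}"] by auto
    moreover have "ball p r \<inter> - {x. n \<bullet> x = c} = ?P \<union> ?N" by (auto simp: inner_commute)
    ultimately show ?thesis by simp
  qed
  \<comment> \<open>The two half discs are dense in the disc, so a closed set containing both
    contains the whole disc.\<close>
  have not_both: "\<not> (?P \<subseteq> R \<and> ?N \<subseteq> R)" if "closed R" "p \<in> closure (- R)" for R
  proof
    assume "?P \<subseteq> R \<and> ?N \<subseteq> R"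
    then have "closure (?P \<union> ?N) \<subseteq> R" using that(1) by (intro closure_minimal) auto
    then have "ball p r \<inter> - R = {}" using dense by blast
    then show False
      using that(2) r(1) open_Int_closure_eq_empty[OF open_ball, of p r "- R"] centre_in_ball[of p r]
      by (metis IntI empty_iff)
  qed
  have "\<not> (?P \<subseteq> inside J1 \<and> ?N \<subseteq> inside J1)" "\<not> (?P \<subseteq> inside J2 \<and> ?N \<subseteq> inside J2)"
    using not_both[OF jr(1)] not_both[OF jr(5)] jr(4,8) p(2) e(2,3) R by blast+
  then show thesis using that[OF r] c R by blast
qed

subsection \<open>Piecewise smooth functions in Sobolev spaces\<close>

lemma distr_of_eq:
  assumes "\<phi> \<in> test_functions U" "U \<subseteq> \<Omega>" "open \<Omega>"
  shows "distr_of \<Omega> f \<phi> = (LINT p|lebesgue. f p * \<phi> p)"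
proof -
  have "distr_of \<Omega> f \<phi> = (LINT p|lebesgue. indicator \<Omega> p *\<^sub>R (f p * \<phi> p))"
    unfolding distr_of_def using assms(3) by (intro integral_restrict_space) (simp add: borel_open)
  also have "(\<lambda>p. indicator \<Omega> p *\<^sub>R (f p * \<phi> p)) = (\<lambda>p. f p * \<phi> p)"
    using assms test_outside[OF assms(1)] by (auto simp: indicator_def fun_eq_iff)
  finally show ?thesis .
qed

text \<open>The product is dominated by the sum of the squares. Values of \<open>f\<close> off
  \<open>\<Omega>\<close> are arbitrary, so measurability is shown for its restriction to
  \<open>\<Omega>\<close>, where \<open>\<phi>\<close> lives.\<close>

lemma L2_integrable_mult_test:
  assumes "f \<in> L2 \<Omega>" "\<phi> \<in> test_functions \<Omega>" "open \<Omega>"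
  shows "integrable lebesgue (\<lambda>p. f p * \<phi> p)"
proof -
  have \<Omega>: "\<Omega> \<inter> space lebesgue \<in> sets lebesgue" using assms(3) by (simp add: borel_open)
  have int: "integrable lebesgue (\<lambda>p. indicator \<Omega> p *\<^sub>R (f p)\<^sup>2)"
    using assms(1) by (simp only: L2_def mem_Collect_eq integrable_restrict_space[OF \<Omega>])
  have "(\<lambda>p. \<phi> p * \<phi> p) \<in> test_functions \<Omega>" by (rule test_mult[OF test_smooth[OF assms(2)] assms(2)])
  then have int2: "integrable lebesgue (\<lambda>p. \<phi> p * \<phi> p)" by (rule integrable_test)
  have meas: "(\<lambda>p. indicator \<Omega> p *\<^sub>R f p) \<in> borel_measurable lebesgue"
    using assms(1) by (simp only: L2_def mem_Collect_eq borel_measurable_restrict_space_iff[OF \<Omega>])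
  have "\<phi> \<in> borel_measurable lebesgue"
    using smooth_borel_measurable[OF test_smooth[OF assms(2)]] by (simp add: measurable_completion)
  with meas have "(\<lambda>p. (indicator \<Omega> p *\<^sub>R f p) * \<phi> p) \<in> borel_measurable lebesgue"
    by (rule borel_measurable_times)
  moreover have "(\<lambda>p. (indicator \<Omega> p *\<^sub>R f p) * \<phi> p) = (\<lambda>p. f p * \<phi> p)"
    using test_outside[OF assms(2)] by (auto simp: indicator_def fun_eq_iff)
  ultimately have m: "(\<lambda>p. f p * \<phi> p) \<in> borel_measurable lebesgue" by simp
  show ?thesis
  proof (rule Bochner_Integration.integrable_bound[OF Bochner_Integration.integrable_add[OF int int2] m])
    have "norm (f p * \<phi> p) \<le> norm (indicator \<Omega> p *\<^sub>R (f p)\<^sup>2 + \<phi> p * \<phi> p)" for p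
    proof (cases "p \<in> \<Omega>")
      case True
      have "2 * (\<bar>f p\<bar> * \<bar>\<phi> p\<bar>) \<le> (f p)\<^sup>2 + (\<phi> p)\<^sup>2"
        using sum_squares_bound[of "\<bar>f p\<bar>" "\<bar>\<phi> p\<bar>"] by (simp add: algebra_simps)
      moreover have "0 \<le> \<bar>f p\<bar> * \<bar>\<phi> p\<bar>" by simp
      ultimately have "\<bar>f p\<bar> * \<bar>\<phi> p\<bar> \<le> (f p)\<^sup>2 + (\<phi> p)\<^sup>2" by linarith
      then show ?thesis using True by (simp add: abs_mult power2_eq_square)
    qed (simp add: test_outside[OF assms(2)])
    then show "AE p in lebesgue. norm (f p * \<phi> p) \<le> norm (indicator \<Omega> p *\<^sub>R (f p)\<^sup>2 + \<phi> p * \<phi> p)" by simp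
  qed
qed

lemma L2_mono:
  assumes "f \<in> L2 \<Omega>" "open \<Omega>" "open W" "W \<subseteq> \<Omega>"
  shows "f \<in> L2 W"
proof -
  have m: "\<Omega> \<inter> space lebesgue \<in> sets lebesgue" "W \<inter> space lebesgue \<in> sets lebesgue" "W \<in> sets lebesgue"
    using assms by (simp_all add: borel_open)
  have f: "(\<lambda>p. indicator \<Omega> p *\<^sub>R f p) \<in> borel_measurable lebesgue"
    "integrable lebesgue (\<lambda>p. indicator \<Omega> p *\<^sub>R (f p)\<^sup>2)"
    using assms(1) by (simp_all only: L2_def mem_Collect_eq
        borel_measurable_restrict_space_iff[OF m(1)] integrable_restrict_space[OF m(1)])
  have *: "(\<lambda>p. indicator W p *\<^sub>R (indicator \<Omega> p *\<^sub>R g p)) = (\<lambda>p. indicator W p *\<^sub>R (g p :: real))" for g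
    using assms(4) by (auto simp: indicator_def fun_eq_iff)
  have "(\<lambda>p. indicator W p *\<^sub>R f p) \<in> borel_measurable lebesgue"
    using borel_measurable_scaleR[OF borel_measurable_indicator[OF m(3)] f(1)] unfolding * .
  moreover have "integrable lebesgue (\<lambda>p. indicator W p *\<^sub>R (f p)\<^sup>2)"
    using integrable_mult_indicator[OF m(3) f(2)] unfolding * .
  ultimately show ?thesis
    by (simp only: L2_def mem_Collect_eq
        borel_measurable_restrict_space_iff[OF m(2)] integrable_restrict_space[OF m(2)])
qed

lemma glue_L2:
  assumes "bounded W" "open W" "closed A" "smooth f" "smooth g"
  shows "glue A f g \<in> L2 W"
proof -
  have W: "W \<inter> space lebesgue \<in> sets lebesgue" "W \<in> sets lborel" using assms by (simp_all add: borel_open)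
  have "glue A f g \<in> borel_measurable borel"
    unfolding glue_def[abs_def] using assms(3-5) by (intro measurable_If_set smooth_borel_measurable) auto
  then have b: "glue A f g \<in> borel_measurable lborel" by simp
  then have m: "glue A f g \<in> borel_measurable lebesgue" by (rule measurable_completion)
  have sq: "integrable lborel (\<lambda>p. indicator W p *\<^sub>R (u p * u p))" if "smooth u" for u
  proof -
    have "integrable lborel (\<lambda>p. indicator W p *\<^sub>R (indicator (closure W) p *\<^sub>R (u p * u p)))"
      using W(2) assms(1) that
      by (intro integrable_mult_indicator borel_integrable_compact smooth_continuous_on smooth_mult) auto
    moreover have "(\<lambda>p. indicator W p *\<^sub>R (indicator (closure W) p *\<^sub>R (u p * u p))) = (\<lambda>p. indicator W p *\<^sub>R (u p * u p))"
      using closure_subset[of W] by (auto simp: indicator_def fun_eq_iff)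
    ultimately show ?thesis by simp
  qed
  have "integrable lborel (\<lambda>p. indicator W p *\<^sub>R (glue A f g p)\<^sup>2)"
  proof (rule Bochner_Integration.integrable_bound[OF Bochner_Integration.integrable_add[OF sq[OF assms(4)] sq[OF assms(5)]]])
    show "(\<lambda>p. indicator W p *\<^sub>R (glue A f g p)\<^sup>2) \<in> borel_measurable lborel"
      using b W(2) by (intro borel_measurable_scaleR borel_measurable_power borel_measurable_indicator)
  qed (auto simp: glue_def indicator_def power2_eq_square)
  then have "integrable lebesgue (\<lambda>p. indicator W p *\<^sub>R (glue A f g p)\<^sup>2)"
    using integrable_completion borel_measurable_integrable by blast
  then show ?thesis
    using m W by (auto simp: L2_def integrable_restrict_space[OF W(1)] intro: measurable_restrict_space1)
qed

section \<open>Distributions given by a pair of smooth functions\<close>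

context line_split
begin

definition represents :: "distribution \<Rightarrow> (plane \<Rightarrow> real) \<Rightarrow> (plane \<Rightarrow> real) \<Rightarrow> bool" where
  "represents L f g \<longleftrightarrow> smooth f \<and> smooth g \<and>
     (\<forall>\<phi>\<in>test_functions W. L \<phi> = (LINT p|lebesgue. glue A1 f g p * \<phi> p))"

text \<open>Each differentiation costs agreement of the current pair on the overlap, and returns a
  smooth pair that can be differentiated again.\<close>

lemma represents_ddx:
  assumes "represents L f g" "\<And>p. p \<in> W \<inter> A1 \<inter> A2 \<Longrightarrow> f p = g p"
  shows "represents (ddx L) (dx f) (dx g)" "represents (ddy L) (dy f) (dy g)"
  using assms integral_by_parts_glue[of f g]
  by (simp_all add: represents_def ddx_def ddy_def smooth_dx smooth_dy test_dx test_dy)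

lemma represents_in_L2:
  assumes "bounded W" "represents L f g"
  shows "distr_in_L2 W L"
  unfolding distr_in_L2_def
  using assms W A1 distr_of_eq[OF _ order_refl W]
  by (intro bexI[of _ "glue A1 f g"] glue_L2) (auto simp: represents_def)

lemma piecewise_smooth_in_sobolev_2:
  assumes "bounded W" "v \<in> L2 W" "represents (distr_of W v) f g"
    and eq: "\<And>p. p \<in> W \<inter> A1 \<inter> A2 \<Longrightarrow> f p = g p" "\<And>p. p \<in> W \<inter> A1 \<inter> A2 \<Longrightarrow> dx f p = dx g p"
      "\<And>p. p \<in> W \<inter> A1 \<inter> A2 \<Longrightarrow> dy f p = dy g p"
  shows "v \<in> sobolev 2 W"
proof -
  let ?L = "distr_of W v"
  note L = assms(3) represents_ddx[OF assms(3) eq(1)]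
  \<comment> \<open>Second derivatives are reached from matching first derivatives. They may
    themselves jump, since they only have to be square integrable.\<close>
  note L2 = represents_ddx(1)[OF L(2) eq(2)] represents_ddx[OF L(3) eq(3)]
  have "distr_in_L2 W ((ddx ^^ i) ((ddy ^^ j) ?L))" if "i + j \<le> 2" for i j
  proof -
    have "(i, j) \<in> {(0, 0), (1, 0), (0, 1), (2, 0), (1, 1), (0, 2)}" using that by auto
    then show ?thesis
      using L L2 represents_in_L2[OF assms(1)] by (auto simp: numeral_2_eq_2)
  qed
  then show ?thesis using assms(2) by (simp add: sobolev_def)
qed

end

text \<open>The local form at a single point, with the triangles removed: in a small disc
  \<open>v\<close> is known almost everywhere on both sides of the line, and test functions
  supported in the disc inherit the weak equations on \<open>\<Omega>\<close>.\<close>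

lemma polynomial_jumps_vanish:
  fixes n :: plane
  assumes \<Omega>: "open \<Omega>" and v: "v \<in> V_space \<Omega>" and n: "norm n = 1" "(fst n)\<^sup>2 \<noteq> (snd n)\<^sup>2"
    and r: "0 < r" "ball p0 r \<subseteq> \<Omega>" and p0: "p0 \<bullet> n = c"
    and f: "smooth f" "smooth g"
    and AE_f: "AE p in lebesgue. p \<in> ball p0 r \<and> c < p \<bullet> n \<longrightarrow> v p = f p"
    and AE_g: "AE p in lebesgue. p \<in> ball p0 r \<and> p \<bullet> n < c \<longrightarrow> v p = g p"
  shows "f p0 = g p0" "dx f p0 = dx g p0" "dy f p0 = dy g p0"
proof -
  interpret half_plane "ball p0 r" n c
    using n by unfold_locales auto
  have vL2: "v \<in> L2 \<Omega>" using v by (simp add: V_space_def sobolev_def)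
  have "distr_in_L2 \<Omega> ((ddx ^^ 1) ((ddy ^^ 0) (distr_of \<Omega> v)))" "distr_in_L2 \<Omega> ((ddx ^^ 0) ((ddy ^^ 1) (distr_of \<Omega> v)))"
    using v unfolding V_space_def sobolev_def by (auto simp only: mem_Collect_eq)
  then have "distr_in_L2 \<Omega> (ddx (distr_of \<Omega> v))" "distr_in_L2 \<Omega> (ddy (distr_of \<Omega> v))" by simp_all
  moreover have "distr_in_L2 \<Omega> (wave_op (distr_of \<Omega> v))" using v by (simp add: V_space_def)
  ultimately obtain gx gy gw where g: "gx \<in> L2 \<Omega>" "gy \<in> L2 \<Omega>" "gw \<in> L2 \<Omega>"
    and eq: "\<And>\<phi>. \<phi> \<in> test_functions \<Omega> \<Longrightarrow> ddx (distr_of \<Omega> v) \<phi> = distr_of \<Omega> gx \<phi>"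
      "\<And>\<phi>. \<phi> \<in> test_functions \<Omega> \<Longrightarrow> ddy (distr_of \<Omega> v) \<phi> = distr_of \<Omega> gy \<phi>"
      "\<And>\<phi>. \<phi> \<in> test_functions \<Omega> \<Longrightarrow> wave_op (distr_of \<Omega> v) \<phi> = distr_of \<Omega> gw \<phi>"
    unfolding distr_in_L2_def by metis
  have "negligible {p. n \<bullet> p = c}" using n0 by (intro negligible_hyperplane) simp
  then have "{p. n \<bullet> p = c} \<in> null_sets lebesgue" by (simp add: negligible_iff_null_sets)
  then have AE_line: "AE p in lebesgue. p \<notin> {p. n \<bullet> p = c}" by (rule AE_not_in)
  have test: "\<phi> \<in> test_functions \<Omega>" if "\<phi> \<in> test_functions (ball p0 r)" for \<phi>
    using that r(2) by (rule test_mono)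
  have v_eq: "distr_of \<Omega> v \<phi> = (LINT p|lebesgue. glue half f g p * \<phi> p)" if \<phi>: "\<phi> \<in> test_functions (ball p0 r)" for \<phi>
  proof -
    have "(LINT p|lebesgue. v p * \<phi> p) = (LINT p|lebesgue. glue half f g p * \<phi> p)"
    proof (rule integral_cong_AE)
      show "(\<lambda>p. v p * \<phi> p) \<in> borel_measurable lebesgue"
        using L2_integrable_mult_test[OF vL2 test[OF \<phi>] \<Omega>] by (rule borel_measurable_integrable)
      show "(\<lambda>p. glue half f g p * \<phi> p) \<in> borel_measurable lebesgue"
        using integrable_glue_test[OF half_borel f \<phi>] by (rule borel_measurable_integrable)
      show "AE p in lebesgue. v p * \<phi> p = glue half f g p * \<phi> p"
        using AE_f AE_g AE_line
      proof eventually_elim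
        case (elim p)
        then show ?case
          using test_outside[OF \<phi>, of p]
          by (cases "p \<in> ball p0 r") (auto simp: glue_def half_def inner_commute not_le)
      qed
    qed
    then show ?thesis using distr_of_eq[OF \<phi> r(2) \<Omega>] by simp
  qed
  have int: "integrable lebesgue (\<lambda>p. - h p * \<phi> p)" "integrable lebesgue (\<lambda>p. h p * \<phi> p)"
    if "h \<in> L2 \<Omega>" "\<phi> \<in> test_functions (ball p0 r)" for h \<phi>
    using L2_integrable_mult_test[OF that(1) test[OF that(2)] \<Omega>] by simp_all
  have jx: "(LINT p|lebesgue. glue half f g p * dx \<phi> p) = (LINT p|lebesgue. - gx p * \<phi> p)"
    if "\<phi> \<in> test_functions (ball p0 r)" for \<phi>
    using eq(1)[OF test[OF that]] v_eq[OF test_dx[OF that]] distr_of_eq[OF that r(2) \<Omega>, of gx]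
    by (simp add: ddx_def)
  have jy: "(LINT p|lebesgue. glue half f g p * dy \<phi> p) = (LINT p|lebesgue. - gy p * \<phi> p)"
    if "\<phi> \<in> test_functions (ball p0 r)" for \<phi>
    using eq(2)[OF test[OF that]] v_eq[OF test_dy[OF that]] distr_of_eq[OF that r(2) \<Omega>, of gy]
    by (simp add: ddy_def)
  \<comment> \<open>Agreement is needed on the whole chord and not only at \<open>p0\<close>,
    because the wave operator is integrated by parts over the disc.\<close>
  have cont: "f p = g p" if "p \<in> ball p0 r" "p \<bullet> n = c" for p
    by (rule weak_gradient_imp_no_jump[where u = "\<lambda>p. - gx p" and v = "\<lambda>p. - gy p", OF f _ jx _ jy that])
      (use int g in auto)
  have p0': "p0 \<in> ball p0 r" using r by simp
  show "f p0 = g p0" by (rule cont[OF p0' p0])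
  have jw: "(LINT p|lebesgue. glue half f g p * dx (dx \<phi>) p) - (LINT p|lebesgue. glue half f g p * dy (dy \<phi>) p)
      = (LINT p|lebesgue. gw p * \<phi> p)" if "\<phi> \<in> test_functions (ball p0 r)" for \<phi>
    using eq(3)[OF test[OF that]] v_eq[OF test_dx[OF test_dx[OF that]]] v_eq[OF test_dy[OF test_dy[OF that]]]
      distr_of_eq[OF that r(2) \<Omega>, of gw]
    by (simp add: wave_op_def ddx_def ddy_def)
  show "dx f p0 = dx g p0" "dy f p0 = dy g p0"
    using weak_wave_imp_no_gradient_jump[where u = gw, OF f cont int(2)[OF g(3)] jw p0' p0 n(2)] by auto
qed

text \<open>If \<open>n\<close> is the tangent (t1, t2) rotated to (-t2, t1), then
  \<open>bar n\<close> is (-t2, -t1). This is plus or minus the tangent exactly when t1 and t2 have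
  equal squares.\<close>

lemma type_II_normal:
  assumes "type_II e"
  obtains a b n where "a \<noteq> b" "e = closed_segment a b" "norm n = 1" "(fst n)\<^sup>2 \<noteq> (snd n)\<^sup>2"
    "e \<subseteq> {p. p \<bullet> n = a \<bullet> n}"
proof -
  obtain a b where ab: "a \<noteq> b" "e = closed_segment a b" and nI: "\<not> type_I e"
    using assms by (auto simp: type_II_def)
  define \<tau> where "\<tau> = (b - a) /\<^sub>R norm (b - a)"
  define n where "n = (- snd \<tau>, fst \<tau>)"
  have \<tau>: "unit_tangent e \<tau>" using ab unfolding unit_tangent_def \<tau>_def by blast
  have norm_\<tau>: "norm \<tau> = 1" using ab by (simp add: \<tau>_def)
  then have norm_n: "norm n = 1" by (simp add: n_def norm_prod_def add.commute)
  have n\<tau>: "n \<bullet> \<tau> = 0" by (simp add: n_def inner_prod_def)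
  have un: "unit_normal e n" using \<tau> norm_n n\<tau> unfolding unit_normal_def by blast
  have "(fst n)\<^sup>2 \<noteq> (snd n)\<^sup>2"
  proof
    assume "(fst n)\<^sup>2 = (snd n)\<^sup>2"
    then have "fst \<tau> = snd \<tau> \<or> fst \<tau> = - snd \<tau>" by (auto simp: n_def power2_eq_iff)
    then have "bar n = \<tau> \<or> bar n = - \<tau>" by (auto simp: bar_def n_def prod_eq_iff)
    then show False using nI un \<tau> unfolding type_I_def by blast
  qed
  moreover have "e \<subseteq> {p. p \<bullet> n = a \<bullet> n}"
  proof -
    have "b - a = norm (b - a) *\<^sub>R \<tau>" using ab by (simp add: \<tau>_def)
    then have "(b - a) \<bullet> n = 0" using n\<tau> by (metis inner_commute inner_scaleR_left mult_zero_right)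
    then have "b \<bullet> n = a \<bullet> n" by (simp add: inner_diff_left)
    then have "((1 - u) *\<^sub>R a + u *\<^sub>R b) \<bullet> n = a \<bullet> n" for u
      by (simp add: inner_add_left left_diff_distrib)
    then show ?thesis unfolding ab(2) closed_segment_def by blast
  qed
  ultimately show thesis using that ab norm_n by blast
qed

theorem lemma3p2:
  fixes \<Omega> :: "plane set" and \<T> :: "triangle set" and X :: "(plane \<Rightarrow> real) set"
    and \<kappa> h :: real and e :: "plane set" and T1 T2 :: triangle
  assumes "bounded_domain \<Omega>" and "piecewise_smooth_boundary \<Omega>"
    and "is_triangulation \<Omega> \<T>" and "\<kappa> > 0" and "quasi_uniform \<kappa> \<T>"
    and "h = mesh_size \<T>" and "0 < h" and "h < 1"
    and "fun_subspace X" and "X \<subseteq> V_space \<Omega>" and "\<forall>v\<in>X. piecewise_polynomial \<T> v"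
    and "e \<in> interior_edges \<T>" and "type_II e"
    and "T1 \<in> \<T>" and "T2 \<in> \<T>" and "e = frontier (region T1) \<inter> frontier (region T2)"
  shows "\<forall>v\<in>X. v \<in> sobolev 2 (interior (region T1 \<union> region T2))"
proof
  fix v assume "v \<in> X"
  obtain a b n where e: "a \<noteq> b" "e = closed_segment a b" and n: "norm n = 1" "(fst n)\<^sup>2 \<noteq> (snd n)\<^sup>2"
    and line: "e \<subseteq> {p. p \<bullet> n = a \<bullet> n}"
    using type_II_normal[OF assms(13)] by blast
  define R1 where "R1 = region T1"
  define R2 where "R2 = region T2"
  define W where "W = interior (R1 \<union> R2)"
  define c where "c = a \<bullet> n"
  note seg = common_segment[OF assms(3,14,15,16) e(2,1), folded R1_def R2_def]
  have J: "is_jordan_curve (\<Union>T1)" "is_jordan_curve (\<Union>T2)"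
    using assms(3,14,15) by (auto simp: is_triangulation_def intro: triangle_jordan)
  have R: "R1 = \<Union>T1 \<union> inside (\<Union>T1)" "R2 = \<Union>T2 \<union> inside (\<Union>T2)"
    by (simp_all add: R1_def R2_def region_def)
  note reg = jordan_region[OF J(1), folded R(1)] jordan_region[OF J(2), folded R(2)]
  have \<Omega>: "open \<Omega>" using assms(1) by (simp add: bounded_domain_def)
  have "R1 \<union> R2 \<subseteq> closure \<Omega>"
    using assms(3,14,15) unfolding is_triangulation_def R1_def R2_def by blast
  \<comment> \<open>The regions are only known to lie in the closure of the domain; the absence of
    slits turns this into an inclusion in the domain, where the weak equations hold.\<close>
  then have W\<Omega>: "W \<subseteq> \<Omega>"
    unfolding W_def using interior_mono interior_closure_domain[OF assms(1,2)] by blast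
  have W_props: "open W" "bounded W" "W \<subseteq> R1 \<union> R2"
    using reg(2,6) bounded_subset[of "R1 \<union> R2" W] interior_subset[of "R1 \<union> R2"] by (auto simp: W_def)
  have v: "v \<in> V_space \<Omega>" using \<open>v \<in> X\<close> assms(10) by blast
  then have vL2: "v \<in> L2 \<Omega>" by (simp add: V_space_def sobolev_def)
  obtain q1 q2 where q: "real_polynomial_function q1" "real_polynomial_function q2"
    and AE: "AE p in lebesgue_on R1. v p = q1 p" "AE p in lebesgue_on R2. v p = q2 p"
    using assms(11,14,15) \<open>v \<in> X\<close> unfolding piecewise_polynomial_def R1_def R2_def by metis
  have sm: "smooth q1" "smooth q2" using q by (auto intro: smooth_real_polynomial)
  have AE1: "AE p in lebesgue. p \<in> R1 \<longrightarrow> v p = q1 p" and AE2: "AE p in lebesgue. p \<in> R2 \<longrightarrow> v p = q2 p"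
    using AE reg(1,5) by (simp_all add: AE_restrict_space_iff)
  have n0: "n \<noteq> 0" using n(1) by auto
  interpret line_split W R1 R2 n c
    using W_props reg(1,5) seg(1) line n0 by unfold_locales (auto simp: c_def)
  have jump: "q1 p = q2 p \<and> dx q1 p = dx q2 p \<and> dy q1 p = dy q2 p" if p: "p \<in> W \<inter> R1 \<inter> R2" for p
  proof -
    have pW: "p \<in> W" "p \<in> e" using p seg(1) by auto
    then have pc: "p \<bullet> n = c" using line by (auto simp: c_def)
    obtain r where r: "0 < r" "ball p r \<subseteq> W"
      "{x \<in> ball p r. c < x \<bullet> n} \<subseteq> R1 \<and> {x \<in> ball p r. x \<bullet> n < c} \<subseteq> R2 \<or>
       {x \<in> ball p r. c < x \<bullet> n} \<subseteq> R2 \<and> {x \<in> ball p r. x \<bullet> n < c} \<subseteq> R1"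
      using half_balls[OF J R seg line[folded c_def] _ pW(2) n0, folded W_def, OF pW(1)] by blast
    have r\<Omega>: "ball p r \<subseteq> \<Omega>" using r(2) W\<Omega> by blast
    \<comment> \<open>The sign of \<open>n\<close> was chosen without regard to the triangles, so
      either region may lie on its positive side; the second case exchanges \<open>q1\<close> and
      \<open>q2\<close>.\<close>
    from r(3) show ?thesis
    proof
      assume s: "{x \<in> ball p r. c < x \<bullet> n} \<subseteq> R1 \<and> {x \<in> ball p r. x \<bullet> n < c} \<subseteq> R2"
      have "AE x in lebesgue. x \<in> ball p r \<and> c < x \<bullet> n \<longrightarrow> v x = q1 x"
        using AE1 by eventually_elim (use s in blast)
      moreover have "AE x in lebesgue. x \<in> ball p r \<and> x \<bullet> n < c \<longrightarrow> v x = q2 x"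
        using AE2 by eventually_elim (use s in blast)
      ultimately show ?thesis
        using polynomial_jumps_vanish[OF \<Omega> v n r(1) r\<Omega> pc sm] by blast
    next
      assume s: "{x \<in> ball p r. c < x \<bullet> n} \<subseteq> R2 \<and> {x \<in> ball p r. x \<bullet> n < c} \<subseteq> R1"
      have "AE x in lebesgue. x \<in> ball p r \<and> c < x \<bullet> n \<longrightarrow> v x = q2 x"
        using AE2 by eventually_elim (use s in blast)
      moreover have "AE x in lebesgue. x \<in> ball p r \<and> x \<bullet> n < c \<longrightarrow> v x = q1 x"
        using AE1 by eventually_elim (use s in blast)
      ultimately show ?thesis
        using polynomial_jumps_vanish[OF \<Omega> v n r(1) r\<Omega> pc sm(2,1)] by simp
    qed
  qed
  have "distr_of W v \<phi> = (LINT p|lebesgue. glue R1 q1 q2 p * \<phi> p)" if \<phi>: "\<phi> \<in> test_functions W" for \<phi>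
  proof -
    have "(LINT p|lebesgue. v p * \<phi> p) = (LINT p|lebesgue. glue R1 q1 q2 p * \<phi> p)"
    proof (rule integral_cong_AE)
      show "(\<lambda>p. v p * \<phi> p) \<in> borel_measurable lebesgue"
        using L2_integrable_mult_test[OF vL2 test_mono[OF \<phi> W\<Omega>] \<Omega>] by (rule borel_measurable_integrable)
      show "(\<lambda>p. glue R1 q1 q2 p * \<phi> p) \<in> borel_measurable lebesgue"
        using integrable_glue_test[OF borel_closed[OF reg(1)] sm \<phi>] by (rule borel_measurable_integrable)
      show "AE p in lebesgue. v p * \<phi> p = glue R1 q1 q2 p * \<phi> p"
        using AE1 AE2
      proof eventually_elim
        case (elim p)
        then show ?case
          using test_outside[OF \<phi>, of p] W_props(3) by (cases "p \<in> W") (auto simp: glue_def)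
      qed
    qed
    then show ?thesis using distr_of_eq[OF \<phi> order_refl W_props(1)] by simp
  qed
  then have "represents (distr_of W v) q1 q2" using sm by (simp add: represents_def)
  then show "v \<in> sobolev 2 (interior (region T1 \<union> region T2))"
    using piecewise_smooth_in_sobolev_2[OF W_props(2) L2_mono[OF vL2 \<Omega> W_props(1) W\<Omega>]] jump
    unfolding W_def R1_def R2_def by blast
qed

end
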